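(* Let $\mathcal{G}$ be a Hausdorff topological group for which there exists $\Delta_0\in\mathsf{RP}(\mathcal{G})$ such that $\eta^{\sharp}(\Delta_0)=\mathfrak{B}_{\mathcal{G}}$, and let $S$ be a subsemigroup of $(\mathsf{LUC}(\mathcal{G})^*,\star)$ such that $S\supseteq\mathcal{G}^{\mathsf{LUC}}\setminus\mathcal{G}$. Then there exists $\nu_0\in S$ such that $$\Lambda(S)=\mathsf{M_u}(\mathcal{G})\cap S=\{\mu\in S : \text{the mapping } \nu\mapsto\mu\star\nu \text{ on } S \text{ is continuous at } \nu_0\},$$ where $S$ carries the $w^*$-topology.
   Context: All topological groups are Hausdorff; $e$ denotes the identity of $\mathcal{G}$. $\mathsf{RP}(\mathcal{G})$ is the set of all right-invariant continuous pseudometrics on $\mathcal{G}$. $\mathcal{G}$ is regarded as a uniform space with the uniformity induced by $\mathsf{RP}(\mathcal{G})$, and $\mathsf{LUC}(\mathcal{G})$ is the Banach space, with sup norm, of bounded complex-valued uniformly continuous functions on this uniform space. For $x\in\mathcal{G}$ and a function $f$ on $\mathcal{G}$, let $\mathsf{L}_xf(y)=f(xy)$. For $\nu\in\mathsf{LUC}(\mathcal{G})^*$ and $f\in\mathsf{LUC}(\mathcal{G})$, the function $\nu\bullet f\in\mathsf{LUC}(\mathcal{G})$ is defined by $(\nu\bullet f)(x)=\langle\nu,\mathsf{L}_xf\rangle$ for $x\in\mathcal{G}$. The convolution on $\mathsf{LUC}(\mathcal{G})^*$ is $\langle\mu\star\nu,f\rangle=\langle\mu,\nu\bullet f\rangle$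 for $\mu,\nu\in\mathsf{LUC}(\mathcal{G})^*$ and $f\in\mathsf{LUC}(\mathcal{G})$; it makes $\mathsf{LUC}(\mathcal{G})^*$ a Banach algebra. For $x\in\mathcal{G}$, $\delta(x)\in\mathsf{LUC}(\mathcal{G})^*$ is the point evaluation at $x$. $\mathcal{G}^{\mathsf{LUC}}$ is the $w^*$-closure of $\delta[\mathcal{G}]$ in $\mathsf{LUC}(\mathcal{G})^*$, with the $w^*$-topology (the uniform compactification of $\mathcal{G}$). $\mathcal{G}$ is identified with $\delta[\mathcal{G}]$, so $\mathcal{G}\subseteq\mathcal{G}^{\mathsf{LUC}}\subseteq\mathsf{LUC}(\mathcal{G})^*$. For a subsemigroup $S$ of $\mathsf{LUC}(\mathcal{G})^*$ with the operation $\star$ and the (relative) $w^*$-topology, the topological centre of $S$ is $\Lambda(S)=\{\mu\in S : \text{for every }\nu_0\in S\text{ the mapping }\nu\mapsto\mu\star\nu\text{ on }S\text{ is continuous at }\nu_0\}$. For $\Delta\in\mathsf{RP}(\mathcal{G})$ put $\mathsf{BLip_b}^+(\Delta)=\{f:\mathcal{G}\to[0,1] : |f(x)-f(y)|\le\Delta(x,y)\text{ for all }x,y\in\mathcal{G}\}$ and $\mathsf{B}(\Delta)=\{x\in\mathcal{G}:\Delta(e,x)<1\}$. The space $\mathsf{M_u}(\mathcal{G})$ of uniform measures is the set of $\mu\in\mathsf{LUC}(\mathcal{G})^*$ such that, for every $\Delta\in\mathsf{RP}(\mathcal{G})$, the restriction of $\mu$ to $\mathsf{BLip_b}^+(\Delta)$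 is continuous for the topology of pointwise convergence on $\mathcal{G}$. For an infinite cardinal $\kappa$, $\mathcal{G}$ is $\kappa$-bounded if for every neighbourhood $U$ of $e$ there is $A\subseteq\mathcal{G}$ with $|A|\le\kappa$ and $\mathcal{G}=UA$ (equivalently, for every $\Delta\in\mathsf{RP}(\mathcal{G})$ there is $A\subseteq\mathcal{G}$ with $|A|\le\kappa$ and $\mathcal{G}=\mathsf{B}(\Delta)A$). $\mathfrak{B}_{\mathcal{G}}$ is the least infinite cardinal $\kappa$ for which $\mathcal{G}$ is $\kappa$-bounded. For $\Delta\in\mathsf{RP}(\mathcal{G})$, $\eta^{\sharp}(\Delta)$ is the least (finite or infinite) cardinal $\kappa$ for which there is $A\subseteq\mathcal{G}$ of cardinality $\kappa$ with $\mathcal{G}=\mathsf{B}(\Delta)A$. *)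

theory Defs
  imports "HOL-Analysis.Analysis"
begin

unbundle cardinal_syntax

text \<open>
  Topological groups are types of the classes \<^class>\<open>topological_group_add\<close> and \<^class>\<open>t2_space\<close>.
  The class \<^class>\<open>group_add\<close> does not assume commutativity, so these are arbitrary Hausdorff
  topological groups: \<open>x + y\<close> stands for the product \<open>xy\<close> (in this order), \<open>0\<close> for the identity
  and \<open>- x\<close> for the inverse.
\<close>

section \<open>Pseudometrics and the space LUC\<close>

definition RP :: "('a::topological_group_add \<Rightarrow> 'a \<Rightarrow> real) set" where
  "RP = {\<Delta>. (\<forall>x y. 0 \<le> \<Delta> x y) \<and> (\<forall>x. \<Delta> x x = 0) \<and> (\<forall>x y. \<Delta> x y = \<Delta> y x) \<and>
             (\<forall>x y z. \<Delta> x z \<le> \<Delta> x y + \<Delta> y z) \<and>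
             continuous_on UNIV (\<lambda>(x, y). \<Delta> x y) \<and>
             (\<forall>x y z. \<Delta> (x + z) (y + z) = \<Delta> x y)}"

text \<open>
  The group is not made an instance of the class \<^class>\<open>uniform_space\<close>; its uniformity is an
  explicit filter, and the condition in \<open>LUC\<close> below is that of \<^const>\<open>uniformly_continuous_on\<close>
  with this filter in place of the class parameter.
\<close>

definition RP_uniformity :: "('a::topological_group_add \<times> 'a) filter" where
  "RP_uniformity = (INF \<Delta>\<in>RP. INF \<epsilon>\<in>{0<..}. principal {(x, y). \<Delta> x y < \<epsilon>})"

definition LUC :: "('a::topological_group_add \<Rightarrow> complex) set" where
  "LUC = {f. bounded (range f) \<and> (LIM (x, y) RP_uniformity. (f x, f y) :> uniformity)}"

section \<open>The dual of LUC\<close>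

text \<open>
  Functionals on \<open>LUC\<close> are encoded as functions on all of \<open>'a \<Rightarrow> complex\<close> with the fixed value
  \<^const>\<open>undefined\<close> outside \<open>LUC\<close>, so that equality of functionals is equality on \<open>LUC\<close>.
\<close>

definition LUC_dual :: "(('a::topological_group_add \<Rightarrow> complex) \<Rightarrow> complex) set" where
  "LUC_dual = {\<mu> \<in> extensional LUC.
     (\<forall>f\<in>LUC. \<forall>g\<in>LUC. \<mu> (\<lambda>x. f x + g x) = \<mu> f + \<mu> g) \<and>
     (\<forall>c. \<forall>f\<in>LUC. \<mu> (\<lambda>x. c * f x) = c * \<mu> f) \<and>
     (\<exists>C. \<forall>f\<in>LUC. cmod (\<mu> f) \<le> C * (SUP x. cmod (f x)))}"

definition weak_star :: "(('a::topological_group_add \<Rightarrow> complex) \<Rightarrow> complex) topology" where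
  "weak_star = subtopology (product_topology (\<lambda>_. euclidean) LUC) LUC_dual"

definition left_translate :: "'a::topological_group_add \<Rightarrow> ('a \<Rightarrow> complex) \<Rightarrow> 'a \<Rightarrow> complex" where
  "left_translate x f = (\<lambda>y. f (x + y))"

definition bullet ::
    "(('a::topological_group_add \<Rightarrow> complex) \<Rightarrow> complex) \<Rightarrow> ('a \<Rightarrow> complex) \<Rightarrow> 'a \<Rightarrow> complex" where
  "bullet \<nu> f = (\<lambda>x. \<nu> (left_translate x f))"

definition convolution ::
    "(('a::topological_group_add \<Rightarrow> complex) \<Rightarrow> complex) \<Rightarrow> (('a \<Rightarrow> complex) \<Rightarrow> complex) \<Rightarrow>
     (('a \<Rightarrow> complex) \<Rightarrow> complex)" (infixl \<open>\<star>\<close> 70) where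
  "\<mu> \<star> \<nu> = (\<lambda>f\<in>LUC. \<mu> (bullet \<nu> f))"

definition subsemigroup_LUC_dual :: "(('a::topological_group_add \<Rightarrow> complex) \<Rightarrow> complex) set \<Rightarrow> bool" where
  "subsemigroup_LUC_dual S \<longleftrightarrow> S \<subseteq> LUC_dual \<and> (\<forall>\<mu>\<in>S. \<forall>\<nu>\<in>S. \<mu> \<star> \<nu> \<in> S)"

definition point_eval :: "'a::topological_group_add \<Rightarrow> ('a \<Rightarrow> complex) \<Rightarrow> complex" where
  "point_eval x = (\<lambda>f\<in>LUC. f x)"

definition uniform_compactification ::
    "(('a::topological_group_add \<Rightarrow> complex) \<Rightarrow> complex) set" where
  "uniform_compactification = weak_star closure_of (range point_eval)"

definition left_mult_continuous_at ::
    "(('a::topological_group_add \<Rightarrow> complex) \<Rightarrow> complex) set \<Rightarrow>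
     (('a \<Rightarrow> complex) \<Rightarrow> complex) \<Rightarrow> (('a \<Rightarrow> complex) \<Rightarrow> complex) \<Rightarrow> bool" where
  "left_mult_continuous_at S \<mu> \<nu>\<^sub>0 \<longleftrightarrow>
     topcontinuous_at (subtopology weak_star S) (subtopology weak_star S) (\<lambda>\<nu>. \<mu> \<star> \<nu>) \<nu>\<^sub>0"

definition topological_centre ::
    "(('a::topological_group_add \<Rightarrow> complex) \<Rightarrow> complex) set \<Rightarrow> (('a \<Rightarrow> complex) \<Rightarrow> complex) set" where
  "topological_centre S = {\<mu> \<in> S. \<forall>\<nu>\<^sub>0\<in>S. left_mult_continuous_at S \<mu> \<nu>\<^sub>0}"

section \<open>Uniform measures\<close>

text \<open>The functions with values in \<open>[0, 1]\<close> are taken as complex-valued ones, as elements of \<open>LUC\<close>.\<close>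

definition BLip_b_plus :: "('a::topological_group_add \<Rightarrow> 'a \<Rightarrow> real) \<Rightarrow> ('a \<Rightarrow> complex) set" where
  "BLip_b_plus \<Delta> =
     {f. range f \<subseteq> complex_of_real ` {0..1} \<and> (\<forall>x y. cmod (f x - f y) \<le> \<Delta> x y)}"

text \<open>
  The topology of the function type \<open>'a \<Rightarrow> complex\<close>, used by \<^const>\<open>continuous_on\<close> here, is that of
  pointwise convergence.
\<close>

definition uniform_measures :: "(('a::topological_group_add \<Rightarrow> complex) \<Rightarrow> complex) set" where
  "uniform_measures = {\<mu> \<in> LUC_dual. \<forall>\<Delta>\<in>RP. continuous_on (BLip_b_plus \<Delta>) \<mu>}"

section \<open>Cardinal invariants\<close>

definition unit_ball :: "('a::topological_group_add \<Rightarrow> 'a \<Rightarrow> real) \<Rightarrow> 'a set" where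
  "unit_ball \<Delta> = {x. \<Delta> 0 x < 1}"

text \<open>\<open>U + A\<close> is the elementwise product of sets.\<close>

definition card_bounded :: "'a::topological_group_add itself \<Rightarrow> 'k rel \<Rightarrow> bool" where
  "card_bounded _ \<kappa> \<longleftrightarrow>
     (\<forall>U::'a set. 0 \<in> interior U \<longrightarrow> (\<exists>A. |A| \<le>o \<kappa> \<and> U + A = UNIV))"

text \<open>
  Both invariants are at most the larger of \<open>\<aleph>\<^sub>0\<close> and the cardinality of the group, so cardinals on
  the type \<open>'a + nat\<close> suffice to represent them. They are determined up to \<open>=o\<close>.
\<close>

definition is_least_cardinal :: "('k rel \<Rightarrow> bool) \<Rightarrow> 'k rel \<Rightarrow> bool" where
  "is_least_cardinal P \<kappa> \<longleftrightarrow>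
     Card_order \<kappa> \<and> P \<kappa> \<and> (\<forall>\<kappa>'. Card_order \<kappa>' \<and> P \<kappa>' \<longrightarrow> \<kappa> \<le>o \<kappa>')"

definition boundedness_number :: "'a::topological_group_add itself \<Rightarrow> ('a + nat) rel" where
  "boundedness_number G = (SOME \<kappa>. is_least_cardinal (\<lambda>\<kappa>. cinfinite \<kappa> \<and> card_bounded G \<kappa>) \<kappa>)"

definition eta_sharp :: "('a::topological_group_add \<Rightarrow> 'a \<Rightarrow> real) \<Rightarrow> ('a + nat) rel" where
  "eta_sharp \<Delta> =
     (SOME \<kappa>. is_least_cardinal (\<lambda>\<kappa>. \<exists>A. |A| =o \<kappa> \<and> unit_ball \<Delta> + A = UNIV) \<kappa>)"

lemma ex_is_least_cardinal:
  assumes "Card_order \<kappa>" "P \<kappa>"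
  shows "\<exists>\<kappa>. is_least_cardinal P \<kappa>"
  using exists_minim_Card_order[of "{\<kappa>. Card_order \<kappa> \<and> P \<kappa>}"] assms
  unfolding is_least_cardinal_def by blast

lemma set_plus_UNIV:
  fixes U :: "'a::group_add set"
  assumes "u \<in> U"
  shows "U + UNIV = UNIV"
proof -
  have "x \<in> U + UNIV" for x
  proof -
    have "u + (- u + x) \<in> U + UNIV"
      using assms by (intro set_plus_intro) auto
    then show ?thesis by (simp add: add.assoc [symmetric])
  qed
  then show ?thesis by auto
qed

lemma boundedness_number_is_least:
  "is_least_cardinal (\<lambda>\<kappa>. cinfinite \<kappa> \<and> card_bounded TYPE('a) \<kappa>)
     (boundedness_number TYPE('a::topological_group_add))"
  unfolding boundedness_number_def
proof (rule someI_ex, rule ex_is_least_cardinal)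
  let ?k = "|UNIV :: ('a + nat) set|"
  show "Card_order ?k" by (rule card_of_Card_order)
  have "|UNIV :: 'a set| \<le>o ?k"
    unfolding card_of_ordLeq[symmetric] by (rule exI[of _ Inl]) auto
  then have "card_bounded TYPE('a) ?k"
    unfolding card_bounded_def using interior_subset set_plus_UNIV by blast
  then show "cinfinite ?k \<and> card_bounded TYPE('a) ?k"
    by (simp add: cinfinite_def Field_card_of finite_Plus_UNIV_iff)
qed

lemma eta_sharp_is_least:
  assumes "\<Delta> \<in> RP"
  shows "is_least_cardinal (\<lambda>\<kappa>. \<exists>A. |A| =o \<kappa> \<and> unit_ball \<Delta> + A = UNIV) (eta_sharp \<Delta>)"
  unfolding eta_sharp_def
proof (rule someI_ex, rule ex_is_least_cardinal)
  let ?k = "|range Inl :: ('a + nat) set|"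
  show "Card_order ?k" by (rule card_of_Card_order)
  have "|UNIV :: 'a set| =o ?k"
    unfolding card_of_ordIso[symmetric] by (rule exI[of _ Inl]) (auto simp: bij_betw_def)
  moreover have "0 \<in> unit_ball \<Delta>"
    using assms by (simp add: unit_ball_def RP_def)
  ultimately show "\<exists>A. |A| =o ?k \<and> unit_ball \<Delta> + A = UNIV"
    using set_plus_UNIV by blast
qed

end

theory Submission
  imports Defs
begin

text \<open>
  Uniform measures lie in the centre. Let \<open>\<mu>\<close> be a uniform measure and \<open>g x = \<mu> (\<lambda>z. f (z + x))\<close>. For a
  Lipschitz \<open>f\<close>, compactness of the bounded Lipschitz functions in the pointwise topology shows that \<open>g\<close>
  is uniformly continuous, and \<open>\<mu> (\<nu> \<bullet> f) = \<nu> g\<close> holds for all \<open>\<nu>\<close>, because both sides depend continuously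
  on \<open>\<nu>\<close> along a bounded net of finitely supported measures. Density of the Lipschitz functions gives this
  for all \<open>f\<close>, and the right-hand side is weak-star continuous in \<open>\<nu>\<close>.

  One point suffices. Let \<open>\<kappa>\<close> be the boundedness number and cover the group by \<open>\<kappa>\<close> many \<open>\<Delta>\<^sub>0\<close>-balls with
  centres \<open>a \<alpha>\<close>. By transfinite recursion choose points \<open>t (p, q)\<close>, for finite \<open>p, q \<subseteq> \<kappa>\<close>, such that the finite
  sets \<open>{a \<alpha> + t (p, q) | \<alpha> \<in> q}\<close> are uniformly separated for \<open>\<Delta>\<^sub>0\<close>. Let \<open>\<nu> p\<close> be a cluster point of
  \<open>t (p, q)\<close> as \<open>q\<close> grows and \<open>\<nu>\<^sub>0\<close> a cluster point of \<open>\<nu> p\<close> as \<open>p\<close> grows. If \<open>\<mu>\<close> is not a uniform measure,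
  there are functions \<open>h p\<close> in some \<open>BLip_b_plus \<Delta>\<close>, converging pointwise to some \<open>g\<close>, with \<open>\<mu> (h p)\<close> bounded
  away from \<open>\<mu> g\<close>; they can be indexed by the finite \<open>p \<subseteq> \<kappa>\<close> since there is a \<open>\<Delta>\<close>-dense set of at most \<open>\<kappa>\<close>
  points. By the separation a single \<open>f\<close> satisfies \<open>\<nu> p \<bullet> f = h p\<close> for all \<open>p\<close>, hence \<open>\<nu>\<^sub>0 \<bullet> f = g\<close>, so that
  \<open>\<nu> \<mapsto> \<mu> \<star> \<nu>\<close> is not continuous at \<open>\<nu>\<^sub>0\<close>.
\<close>

section \<open>Right-invariant pseudometrics and LUC\<close>

lemma RP_iff:
  "\<Delta> \<in> RP \<longleftrightarrow> (\<forall>x y. 0 \<le> \<Delta> x y) \<and> (\<forall>x. \<Delta> x x = 0) \<and> (\<forall>x y. \<Delta> x y = \<Delta> y x) \<and>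
     (\<forall>x y z. \<Delta> x z \<le> \<Delta> x y + \<Delta> y z) \<and> continuous_on UNIV (\<lambda>p. \<Delta> (fst p) (snd p)) \<and>
     (\<forall>x y z. \<Delta> (x + z) (y + z) = \<Delta> x y)"
  by (simp add: RP_def case_prod_unfold)

lemma
  assumes "\<Delta> \<in> RP"
  shows RP_nonneg: "0 \<le> \<Delta> x y"
    and RP_refl: "\<Delta> x x = 0"
    and RP_commute: "\<Delta> x y = \<Delta> y x"
    and RP_triangle: "\<Delta> x z \<le> \<Delta> x y + \<Delta> y z"
    and RP_right_invariant: "\<Delta> (x + z) (y + z) = \<Delta> x y"
  using assms unfolding RP_iff by blast+

lemma RP_continuous:
  assumes "\<Delta> \<in> RP" "continuous_on A f" "continuous_on A g"
  shows "continuous_on A (\<lambda>x. \<Delta> (f x) (g x))"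
proof -
  have "continuous_on UNIV (\<lambda>p. \<Delta> (fst p) (snd p))"
    using assms(1) unfolding RP_iff by blast
  from continuous_on_compose2[OF this continuous_on_Pair[OF assms(2,3)]]
  show ?thesis by simp
qed

lemma RP_zero: "(\<lambda>x y. 0) \<in> RP"
  by (simp add: RP_iff)

lemma RP_add:
  assumes "\<Delta> \<in> RP" "D \<in> RP"
  shows "(\<lambda>x y. \<Delta> x y + D x y) \<in> RP"
  unfolding RP_iff
proof (intro conjI allI)
  show "\<Delta> x z + D x z \<le> \<Delta> x y + D x y + (\<Delta> y z + D y z)" for x y z
    using RP_triangle[OF assms(1), of x z y] RP_triangle[OF assms(2), of x z y] by linarith
  show "\<Delta> x y + D x y = \<Delta> y x + D y x" for x y
    using RP_commute[OF assms(1)] RP_commute[OF assms(2)] by metis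
  show "continuous_on UNIV (\<lambda>p. \<Delta> (fst p) (snd p) + D (fst p) (snd p))"
    by (intro continuous_intros RP_continuous[OF assms(1)] RP_continuous[OF assms(2)])
qed (use assms in \<open>simp_all add: RP_nonneg RP_refl RP_right_invariant\<close>)

lemma RP_scale:
  assumes "\<Delta> \<in> RP" "0 \<le> c"
  shows "(\<lambda>x y. c * \<Delta> x y) \<in> RP"
  unfolding RP_iff
proof (intro conjI allI)
  show "c * \<Delta> x z \<le> c * \<Delta> x y + c * \<Delta> y z" for x y z
    using RP_triangle[OF assms(1), of x z y] assms(2)
    by (metis distrib_left mult_left_mono)
  show "c * \<Delta> x y = c * \<Delta> y x" for x y
    using RP_commute[OF assms(1)] by metis
  show "continuous_on UNIV (\<lambda>p. c * \<Delta> (fst p) (snd p))"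
    by (intro continuous_intros RP_continuous[OF assms(1)])
qed (use assms in \<open>simp_all add: RP_nonneg RP_refl RP_right_invariant\<close>)

text \<open>By right invariance this is the conjugate pseudometric
  \<open>\<Delta> (a + x - a) (a + y - a)\<close>, in general different from
  \<open>\<Delta>\<close>. It witnesses the uniform continuity of left translates.\<close>

lemma RP_left_translate:
  assumes "\<Delta> \<in> RP"
  shows "(\<lambda>x y. \<Delta> (a + x) (a + y)) \<in> RP"
  unfolding RP_iff
proof (intro conjI allI)
  show "\<Delta> (a + x) (a + z) \<le> \<Delta> (a + x) (a + y) + \<Delta> (a + y) (a + z)" for x y z
    by (rule RP_triangle[OF assms])
  show "\<Delta> (a + x) (a + y) = \<Delta> (a + y) (a + x)" for x y
    by (rule RP_commute[OF assms])
  show "\<Delta> (a + (x + z)) (a + (y + z)) = \<Delta> (a + x) (a + y)" for x y z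
    using RP_right_invariant[OF assms, of "a + x" z "a + y"] by (simp add: add.assoc)
  show "continuous_on UNIV (\<lambda>p. \<Delta> (a + fst p) (a + snd p))"
    by (intro continuous_intros RP_continuous[OF assms(1)])
qed (use assms in \<open>simp_all add: RP_nonneg RP_refl\<close>)

text \<open>Scaling turns any radius into 1 and sums of pseudometrics are upper bounds, so the unit
  entourages alone form a directed base of the filter.\<close>

lemma eventually_RP_uniformity:
  fixes P :: "'a::topological_group_add \<times> 'a \<Rightarrow> bool"
  shows "eventually P RP_uniformity \<longleftrightarrow> (\<exists>\<Delta>\<in>RP. \<forall>x y. \<Delta> x y < 1 \<longrightarrow> P (x, y))"
proof -
  let ?B = "\<lambda>\<Delta> :: 'a \<Rightarrow> 'a \<Rightarrow> real. principal {(x, y). \<Delta> x y < (1::real)}"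
  have "RP_uniformity = (INF \<Delta>\<in>RP. ?B \<Delta>)"
  proof (rule antisym)
    show "RP_uniformity \<le> (INF \<Delta>\<in>RP. ?B \<Delta>)"
      unfolding RP_uniformity_def by (intro INF_mono) (auto intro!: INF_lower2[of 1])
    have "(INF \<Delta>\<in>RP. ?B \<Delta>) \<le> principal {(x, y). \<Delta> x y < \<epsilon>}"
      if "\<Delta> \<in> RP" "0 < \<epsilon>" for \<Delta> :: "'a \<Rightarrow> 'a \<Rightarrow> real" and \<epsilon>
    proof -
      have "{(x, y). (1 / \<epsilon>) * \<Delta> x y < 1} = {(x, y). \<Delta> x y < \<epsilon>}"
        using that by (auto simp: field_simps)
      then show ?thesis
        using RP_scale[OF that(1), of "1 / \<epsilon>"] that(2)
        by (intro INF_lower2[of "\<lambda>x y. (1 / \<epsilon>) * \<Delta> x y"]) auto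
    qed
    then show "(INF \<Delta>\<in>RP. ?B \<Delta>) \<le> RP_uniformity"
      unfolding RP_uniformity_def by (intro INF_greatest) auto
  qed
  moreover have "\<exists>E\<in>RP. ?B E \<le> inf (?B \<Delta>) (?B D)" if "\<Delta> \<in> RP" "D \<in> RP" for \<Delta> D :: "'a \<Rightarrow> 'a \<Rightarrow> real"
    using that
    by (intro bexI[OF _ RP_add[OF that]]) (auto, (smt (verit) RP_nonneg)+)
  moreover have "(RP :: ('a \<Rightarrow> 'a \<Rightarrow> real) set) \<noteq> {}"
    using RP_zero by blast
  ultimately show ?thesis
    by (subst \<open>RP_uniformity = _\<close>, subst eventually_INF_base) (auto simp: eventually_principal)
qed

lemma LUC_iff:
  "f \<in> LUC \<longleftrightarrow> bounded (range f) \<and>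
     (\<forall>\<epsilon>>0. \<exists>\<Delta>\<in>RP. \<forall>x y. \<Delta> x y < 1 \<longrightarrow> dist (f x) (f y) < \<epsilon>)"
proof -
  have "(LIM (x, y) RP_uniformity. (f x, f y) :> uniformity) \<longleftrightarrow>
      (\<forall>\<epsilon>>0. eventually (\<lambda>(x, y). dist (f x) (f y) < \<epsilon>) RP_uniformity)"
    by (simp add: uniformity_dist filterlim_INF filterlim_principal case_prod_unfold Ball_def)
  then show ?thesis
    by (simp add: LUC_def eventually_RP_uniformity)
qed

lemma LUC_bounded:
  assumes "f \<in> LUC"
  obtains C where "0 \<le> C" "\<And>x. cmod (f x) \<le> C"
proof -
  have "bounded (range f)"
    using assms LUC_iff by blast
  then obtain C where C: "\<And>x. cmod (f x) \<le> C"
    by (auto simp: bounded_iff)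
  show ?thesis
    by (rule that[of "max C 0"]) (auto simp: le_max_iff_disj C)
qed

lemma LUC_uniform:
  assumes "f \<in> LUC" "0 < \<epsilon>"
  obtains \<Delta> where "\<Delta> \<in> RP" "\<And>x y. \<Delta> x y < 1 \<Longrightarrow> dist (f x) (f y) < \<epsilon>"
proof -
  have "\<exists>\<Delta>\<in>RP. \<forall>x y. \<Delta> x y < 1 \<longrightarrow> dist (f x) (f y) < \<epsilon>"
    using assms LUC_iff[of f] by simp
  then show ?thesis using that by blast
qed

lemma LUC_finite_uniform:
  assumes "finite \<Phi>" "\<Phi> \<subseteq> LUC" "0 < \<epsilon>"
  shows "\<exists>\<Delta>\<in>RP. \<forall>x y. \<Delta> x y < 1 \<longrightarrow> (\<forall>f\<in>\<Phi>. dist (f x) (f y) < \<epsilon>)"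
  using assms(1,2)
proof (induction rule: finite_induct)
  case empty
  then show ?case using RP_zero by blast
next
  case (insert g \<Phi>)
  then obtain \<Delta> where D: "\<Delta> \<in> RP" "\<And>x y f. \<Delta> x y < 1 \<Longrightarrow> f \<in> \<Phi> \<Longrightarrow> dist (f x) (f y) < \<epsilon>"
    by auto
  have "g \<in> LUC" using insert.prems by simp
  then obtain D where D': "D \<in> RP" "\<And>x y. D x y < 1 \<Longrightarrow> dist (g x) (g y) < \<epsilon>"
    using LUC_uniform[OF _ assms(3)] by blast
  have *: "\<Delta> x y < 1 \<and> D x y < 1" if "\<Delta> x y + D x y < 1" for x y
    using that RP_nonneg[OF D(1), of x y] RP_nonneg[OF D'(1), of x y] by linarith
  show ?case
  proof (intro bexI[OF _ RP_add[OF D(1) D'(1)]] allI impI ballI)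
    fix x y f assume "\<Delta> x y + D x y < 1" "f \<in> insert g \<Phi>"
    then show "dist (f x) (f y) < \<epsilon>"
      using D(2) D'(2) * by auto
  qed
qed

text \<open>Oscillation controlled by finitely many members of \<open>LUC\<close> is uniformly
  small. Sums, multiples, constants (with \<open>\<Phi>\<close> empty) and the partition functions
  below are all instances.\<close>

lemma LUC_dominated:
  assumes "finite \<Phi>" "\<Phi> \<subseteq> LUC" "\<And>x. cmod (g x) \<le> C"
    and "\<And>x y. cmod (g x - g y) \<le> K * (\<Sum>f\<in>\<Phi>. cmod (f x - f y))"
  shows "g \<in> LUC"
  unfolding LUC_iff
proof (intro conjI allI impI)
  show "bounded (range g)"
    using assms(3) by (auto simp: bounded_iff)
  fix \<epsilon> :: real assume "0 < \<epsilon>"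
  \<comment> \<open>The summand 1 keeps \<open>L\<close> positive when \<open>\<Phi>\<close> is
    empty or \<open>K = 0\<close>, and makes the last inequality strict.\<close>
  define L where "L = \<bar>K\<bar> * card \<Phi> + 1"
  have "L > 0" unfolding L_def by (simp add: add_nonneg_pos)
  then obtain \<Delta> where \<Delta>: "\<Delta> \<in> RP" "\<And>x y f. \<Delta> x y < 1 \<Longrightarrow> f \<in> \<Phi> \<Longrightarrow> dist (f x) (f y) < \<epsilon> / L"
    using LUC_finite_uniform[OF assms(1,2), of "\<epsilon> / L"] \<open>0 < \<epsilon>\<close> by auto
  have "dist (g x) (g y) < \<epsilon>" if "\<Delta> x y < 1" for x y
  proof -
    have "cmod (g x - g y) \<le> \<bar>K\<bar> * (\<Sum>f\<in>\<Phi>. cmod (f x - f y))"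
      by (rule order_trans[OF assms(4)]) (intro mult_right_mono sum_nonneg, auto)
    also have "\<dots> \<le> \<bar>K\<bar> * (\<Sum>f\<in>\<Phi>. \<epsilon> / L)"
      using \<Delta>(2)[OF that] by (intro mult_left_mono sum_mono) (auto simp: dist_norm less_imp_le)
    also have "\<dots> = (L - 1) * (\<epsilon> / L)"
      by (simp add: L_def)
    also have "\<dots> < L * (\<epsilon> / L)"
      using \<open>L > 0\<close> \<open>0 < \<epsilon>\<close> by (intro mult_strict_right_mono) auto
    finally show ?thesis
      using \<open>L > 0\<close> by (simp add: dist_norm)
  qed
  with \<Delta>(1) show "\<exists>\<Delta>\<in>RP. \<forall>x y. \<Delta> x y < 1 \<longrightarrow> dist (g x) (g y) < \<epsilon>" by blast
qed

lemma LUC_add: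
  assumes "f \<in> LUC" "g \<in> LUC"
  shows "(\<lambda>x. f x + g x) \<in> LUC"
proof -
  obtain C D where C: "\<And>x. cmod (f x) \<le> C" "\<And>x. cmod (g x) \<le> D"
    using LUC_bounded assms by metis
  show ?thesis
  proof (rule LUC_dominated[of "{f, g}" _ "C + D" 2])
    show "cmod (f x + g x) \<le> C + D" for x
      using C by (intro norm_triangle_le add_mono)
    show "cmod (f x + g x - (f y + g y)) \<le> 2 * (\<Sum>h\<in>{f, g}. cmod (h x - h y))" for x y
    proof -
      have "cmod (h x - h y) \<le> (\<Sum>h\<in>{f, g}. cmod (h x - h y))" if "h \<in> {f, g}" for h
        using that by (intro member_le_sum) auto
      from this[of f] this[of g] show ?thesis
        using norm_triangle_ineq[of "f x - f y" "g x - g y"] by (simp add: algebra_simps)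
    qed
  qed (use assms in auto)
qed

lemma LUC_cmult:
  assumes "f \<in> LUC"
  shows "(\<lambda>x. c * f x) \<in> LUC"
proof -
  obtain C where C: "\<And>x. cmod (f x) \<le> C"
    using LUC_bounded assms by metis
  show ?thesis
    by (rule LUC_dominated[of "{f}" _ "cmod c * C" "cmod c"])
      (use assms C in \<open>auto simp: norm_mult mult_left_mono simp flip: right_diff_distrib\<close>)
qed

lemma LUC_const: "(\<lambda>x. c) \<in> LUC"
  by (rule LUC_dominated[of "{}" _ "cmod c" 0]) auto

lemma LUC_diff:
  assumes "f \<in> LUC" "g \<in> LUC"
  shows "(\<lambda>x. f x - g x) \<in> LUC"
  using LUC_add[OF assms(1) LUC_cmult[OF assms(2), of "-1"]] by simp

lemma LUC_sum:
  assumes "\<And>i. i \<in> I \<Longrightarrow> f i \<in> LUC"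
  shows "(\<lambda>x. \<Sum>i\<in>I. f i x) \<in> LUC"
  using assms by (induction I rule: infinite_finite_induct) (auto intro: LUC_const LUC_add)

lemma LUC_left_translate:
  assumes "f \<in> LUC"
  shows "left_translate a f \<in> LUC"
  unfolding LUC_iff
proof (intro conjI allI impI)
  obtain C where "\<And>x. cmod (f x) \<le> C"
    using LUC_bounded[OF assms] by metis
  then show "bounded (range (left_translate a f))"
    by (auto simp: bounded_iff left_translate_def)
  fix \<epsilon> :: real assume "0 < \<epsilon>"
  then obtain \<Delta> where "\<Delta> \<in> RP" "\<And>x y. \<Delta> x y < 1 \<Longrightarrow> dist (f x) (f y) < \<epsilon>"
    using LUC_uniform[OF assms] by metis
  then show "\<exists>\<Delta>\<in>RP. \<forall>x y. \<Delta> x y < 1 \<longrightarrow> dist (left_translate a f x) (left_translate a f y) < \<epsilon>"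
    by (intro bexI[OF _ RP_left_translate[of \<Delta> a]]) (auto simp: left_translate_def)
qed

lemma LUC_uniform_limit:
  assumes "\<And>\<epsilon>. 0 < \<epsilon> \<Longrightarrow> \<exists>g\<in>LUC. \<forall>x. cmod (f x - g x) \<le> \<epsilon>"
  shows "f \<in> LUC"
  unfolding LUC_iff
proof (intro conjI allI impI)
  obtain g where g: "g \<in> LUC" "\<And>x. cmod (f x - g x) \<le> 1"
    using assms[of 1] by auto
  obtain C where C: "\<And>x. cmod (g x) \<le> C"
    using LUC_bounded g(1) by metis
  have "cmod (f x) \<le> 1 + C" for x
    using g(2)[of x] C[of x] norm_triangle_sub[of "f x" "g x"] by linarith
  then show "bounded (range f)"
    by (auto simp: bounded_iff)
  fix \<epsilon> :: real assume "0 < \<epsilon>"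
  then obtain g where g: "g \<in> LUC" "\<And>x. cmod (f x - g x) \<le> \<epsilon> / 4"
    using assms[of "\<epsilon> / 4"] by auto
  obtain \<Delta> where \<Delta>: "\<Delta> \<in> RP" "\<And>x y. \<Delta> x y < 1 \<Longrightarrow> dist (g x) (g y) < \<epsilon> / 4"
    using LUC_uniform[OF g(1), of "\<epsilon> / 4"] \<open>0 < \<epsilon>\<close> by auto
  have "dist (f x) (f y) < \<epsilon>" if "\<Delta> x y < 1" for x y
    using g(2)[of x] g(2)[of y] \<Delta>(2)[OF that] \<open>0 < \<epsilon>\<close>
      dist_triangle[of "f x" "f y" "g x"] dist_triangle2[of "g x" "f y" "g y"]
    unfolding dist_norm by linarith
  with \<Delta>(1) show "\<exists>\<Delta>\<in>RP. \<forall>x y. \<Delta> x y < 1 \<longrightarrow> dist (f x) (f y) < \<epsilon>" by blast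
qed

section \<open>The dual of LUC\<close>

lemma
  assumes "\<mu> \<in> LUC_dual"
  shows dual_add: "f \<in> LUC \<Longrightarrow> g \<in> LUC \<Longrightarrow> \<mu> (\<lambda>x. f x + g x) = \<mu> f + \<mu> g"
    and dual_cmult: "f \<in> LUC \<Longrightarrow> \<mu> (\<lambda>x. c * f x) = c * \<mu> f"
    and dual_extensional: "\<mu> \<in> extensional LUC"
  using assms unfolding LUC_dual_def by blast+

text \<open>Any pointwise bound \<open>M\<close> may replace the supremum norm.
  \<open>LUC_dual\<close> states no sign for its constant, so \<open>max C 0\<close> supplies
  one.\<close>

lemma dual_bound:
  fixes \<mu> :: "('a::topological_group_add \<Rightarrow> complex) \<Rightarrow> complex"
  assumes "\<mu> \<in> LUC_dual"
  obtains C where "0 \<le> C"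
    "\<And>f M. f \<in> LUC \<Longrightarrow> (\<And>x. cmod (f x) \<le> M) \<Longrightarrow> cmod (\<mu> f) \<le> C * M"
proof -
  obtain C where C: "\<And>f. f \<in> LUC \<Longrightarrow> cmod (\<mu> f) \<le> C * (SUP x. cmod (f x))"
    using assms unfolding LUC_dual_def by blast
  show ?thesis
  proof (rule that[of "max C 0"])
    fix f :: "'a \<Rightarrow> complex" and M assume f: "f \<in> LUC" and M: "\<And>x. cmod (f x) \<le> M"
    have "0 \<le> (SUP x. cmod (f x))"
      using M by (intro cSUP_upper2[of _ _ undefined]) (auto simp: bdd_above_def)
    then have "C * (SUP x. cmod (f x)) \<le> max C 0 * (SUP x. cmod (f x))"
      by (intro mult_right_mono) auto
    also have "\<dots> \<le> max C 0 * M"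
      using M by (intro mult_left_mono cSUP_least) auto
    finally show "cmod (\<mu> f) \<le> max C 0 * M"
      using C[OF f] by linarith
  qed auto
qed

lemma dual_lincomb:
  assumes "\<mu> \<in> LUC_dual" "f \<in> LUC" "g \<in> LUC"
  shows "\<mu> (\<lambda>x. a * f x + b * g x) = a * \<mu> f + b * \<mu> g"
  by (simp only: dual_add[OF assms(1) LUC_cmult[OF assms(2)] LUC_cmult[OF assms(3)]]
      dual_cmult[OF assms(1,2)] dual_cmult[OF assms(1,3)])

lemma dual_diff:
  assumes "\<mu> \<in> LUC_dual" "f \<in> LUC" "g \<in> LUC"
  shows "\<mu> (\<lambda>x. f x - g x) = \<mu> f - \<mu> g"
  using dual_lincomb[OF assms, of 1 "-1"] by simp

lemma dual_sum:
  assumes "\<mu> \<in> LUC_dual" "finite I" "\<And>i. i \<in> I \<Longrightarrow> f i \<in> LUC"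
  shows "\<mu> (\<lambda>x. \<Sum>i\<in>I. c i * f i x) = (\<Sum>i\<in>I. c i * \<mu> (f i))"
  using assms(2,3)
proof (induction rule: finite_induct)
  case empty
  then show ?case
    using dual_cmult[OF assms(1) LUC_const, of 0 0] by simp
next
  case (insert i I)
  have "(\<lambda>x. \<Sum>i\<in>I. c i * f i x) \<in> LUC"
    using insert by (intro LUC_sum LUC_cmult) auto
  then show ?case
    using insert by (simp add: dual_add[OF assms(1)] dual_cmult[OF assms(1)] LUC_cmult)
qed

section \<open>Bounded Lipschitz functions and uniform measures\<close>

text \<open>The complex-valued, scaled counterpart of \<open>BLip_b_plus\<close>. Applying
  \<open>bullet \<nu>\<close> does not preserve the range \<open>{0..1}\<close>, but it leads from
  one class of this form to another.\<close>

definition clipschitz :: "real \<Rightarrow> ('a \<Rightarrow> 'a \<Rightarrow> real) \<Rightarrow> ('a \<Rightarrow> complex) set" where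
  "clipschitz C \<Delta> = {h. (\<forall>x. cmod (h x) \<le> C) \<and> (\<forall>x y. cmod (h x - h y) \<le> \<Delta> x y)}"

lemma clipschitz_LUC:
  assumes "\<Delta> \<in> RP" "h \<in> clipschitz C \<Delta>"
  shows "h \<in> LUC"
  unfolding LUC_iff
proof (intro conjI allI impI)
  show "bounded (range h)"
    using assms(2) by (auto simp: bounded_iff clipschitz_def)
  fix \<epsilon> :: real assume "0 < \<epsilon>"
  have "dist (h x) (h y) < \<epsilon>" if "1 / \<epsilon> * \<Delta> x y < 1" for x y
  proof -
    have "dist (h x) (h y) \<le> \<Delta> x y"
      using assms(2) by (simp add: clipschitz_def dist_norm)
    also have "\<dots> < \<epsilon>"
      using that \<open>0 < \<epsilon>\<close> by (simp add: field_simps)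
    finally show ?thesis .
  qed
  then show "\<exists>\<Delta>\<in>RP. \<forall>x y. \<Delta> x y < 1 \<longrightarrow> dist (h x) (h y) < \<epsilon>"
    using RP_scale[OF assms(1), of "1 / \<epsilon>"] \<open>0 < \<epsilon>\<close> by (intro bexI) auto
qed

lemma BLip_b_plus_clipschitz: "BLip_b_plus \<Delta> \<subseteq> clipschitz 1 \<Delta>"
  by (auto simp: BLip_b_plus_def clipschitz_def)
    (metis atLeastAtMost_iff image_iff norm_of_real abs_of_nonneg range_subsetD)

lemma continuous_on_proj: "continuous_on A (\<lambda>h. h x)"
  by (rule continuous_on_subset[OF continuous_on_product_coordinates]) simp

lemma clipschitz_right_translate:
  assumes "\<Delta> \<in> RP" "h \<in> clipschitz C \<Delta>"
  shows "(\<lambda>y. h (y + x)) \<in> clipschitz C \<Delta>"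
  using assms(2) RP_right_invariant[OF assms(1)] unfolding clipschitz_def by (auto, metis)

text \<open>Tychonoff: the class is a pointwise closed subset of a product of discs.\<close>

lemma compact_clipschitz: "compact (clipschitz C \<Delta>)"
proof -
  have "compact (\<Pi>\<^sub>E x\<in>UNIV. cball (0::complex) C)"
  proof -
    have "compactin (product_topology (\<lambda>_. euclidean) UNIV) (\<Pi>\<^sub>E x\<in>UNIV. cball (0::complex) C)"
      by (subst compactin_PiE) simp
    then show ?thesis
      by (simp add: euclidean_product_topology)
  qed
  moreover have "closed (clipschitz C \<Delta>)"
    unfolding clipschitz_def
    by (intro closed_Collect_conj closed_Collect_all closed_Collect_le continuous_on_norm
        continuous_on_diff continuous_on_proj continuous_on_const)
  ultimately have "compact ((\<Pi>\<^sub>E x\<in>UNIV. cball (0::complex) C) \<inter> clipschitz C \<Delta>)"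
    by (rule compact_Int_closed)
  moreover have "(\<Pi>\<^sub>E x\<in>UNIV. cball (0::complex) C) \<inter> clipschitz C \<Delta> = clipschitz C \<Delta>"
    by (auto simp: clipschitz_def)
  ultimately show ?thesis by simp
qed

text \<open>Linearity of \<open>\<mu>\<close> carries continuity over from
  \<open>BLip_b_plus\<close>: an affine map depending only on \<open>C\<close> moves real and
  imaginary parts into \<open>{0..1}\<close>.\<close>

lemma uniform_measure_continuous:
  assumes "\<mu> \<in> uniform_measures" "\<Delta> \<in> RP"
  shows "continuous_on (clipschitz C \<Delta>) \<mu>"
proof -
  define K where "K = max C 1"
  have "K > 0" by (simp add: K_def)
  have dual: "\<mu> \<in> LUC_dual"
    using assms(1) by (simp add: uniform_measures_def)
  have sub: "clipschitz C \<Delta> \<subseteq> clipschitz K \<Delta>"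
    unfolding clipschitz_def K_def using le_max_iff_disj by blast
  let ?D = "\<lambda>x y. 1 / (2 * K) * \<Delta> x y"
  have D: "?D \<in> RP"
    using \<open>K > 0\<close> by (intro RP_scale assms) auto
  have cont: "continuous_on (BLip_b_plus ?D) \<mu>"
    using assms(1) D by (simp add: uniform_measures_def)
  \<comment> \<open>Here \<open>p\<close> stands for \<open>Re\<close> or \<open>Im\<close>. Values
    in \<open>[-K, K]\<close> are mapped onto \<open>[0, 1]\<close>, which divides Lipschitz bounds
    by \<open>2 * K\<close> and explains \<open>?D\<close>.\<close>
  define N where "N p h = (\<lambda>x. complex_of_real (p (h x) / (2 * K) + 1 / 2))"
    for p :: "complex \<Rightarrow> real" and h :: "'a \<Rightarrow> complex"
  have N: "N p h \<in> BLip_b_plus ?D"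
    if h: "h \<in> clipschitz K \<Delta>" and p: "\<And>z. \<bar>p z\<bar> \<le> cmod z" "\<And>z w. p (z - w) = p z - p w" for p h
  proof -
    have hx: "cmod (h x) \<le> K" for x
      using h by (simp add: clipschitz_def)
    have *: "\<bar>p (h x)\<bar> \<le> K" for x
      using p(1)[of "h x"] hx[of x] by linarith
    have "N p h x \<in> complex_of_real ` {0..1}" for x
      unfolding N_def using *[of x] \<open>K > 0\<close> by (intro imageI) (auto simp: field_simps abs_le_iff)
    moreover have "cmod (N p h x - N p h y) \<le> ?D x y" for x y
    proof -
      have "N p h x - N p h y = complex_of_real (1 / (2 * K) * p (h x - h y))"
        by (simp add: N_def p(2) diff_divide_distrib)
      then have "cmod (N p h x - N p h y) = 1 / (2 * K) * \<bar>p (h x - h y)\<bar>"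
        using \<open>K > 0\<close> by (simp only: norm_of_real abs_mult) simp
      also have "\<bar>p (h x - h y)\<bar> \<le> \<Delta> x y"
        using p(1)[of "h x - h y"] h unfolding clipschitz_def by (smt (verit) mem_Collect_eq)
      finally show ?thesis
        using \<open>K > 0\<close> by (simp add: divide_right_mono)
    qed
    ultimately show ?thesis
      by (auto simp: BLip_b_plus_def)
  qed
  have decomp: "\<mu> h = 2 * K * \<mu> (N Re h) + (2 * K * \<i> * \<mu> (N Im h) + - (K + K * \<i>) * \<mu> (\<lambda>x. 1))"
    if h: "h \<in> clipschitz K \<Delta>" for h
  proof -
    have L: "N Re h \<in> LUC" "N Im h \<in> LUC"
      using N[OF h, of Re] N[OF h, of Im] clipschitz_LUC[OF D] BLip_b_plus_clipschitz
      by (auto simp: abs_Re_le_cmod abs_Im_le_cmod)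
    \<comment> \<open>The constant \<open>K + K * \<i>\<close> undoes the two shifts by 1/2.\<close>
    define g where "g = (\<lambda>x. 2 * K * \<i> * N Im h x + - (K + K * \<i>) * 1)"
    have "h = (\<lambda>x. 2 * K * N Re h x + 1 * g x)"
      using \<open>K > 0\<close> by (auto simp: N_def g_def complex_eq_iff field_simps)
    moreover have "g \<in> LUC"
      unfolding g_def by (intro LUC_add LUC_cmult L LUC_const)
    ultimately have "\<mu> h = 2 * K * \<mu> (N Re h) + 1 * \<mu> g"
      using dual_lincomb[OF dual L(1)] by metis
    moreover have "\<mu> g = 2 * K * \<i> * \<mu> (N Im h) + - (K + K * \<i>) * \<mu> (\<lambda>x. 1)"
      unfolding g_def by (rule dual_lincomb[OF dual L(2) LUC_const])
    ultimately show ?thesis by simp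
  qed
  have "continuous_on (clipschitz K \<Delta>) (\<lambda>h. \<mu> (N p h))"
    if p: "\<And>z. \<bar>p z\<bar> \<le> cmod z" "\<And>z w. p (z - w) = p z - p w" "continuous_on UNIV p" for p
  proof (rule continuous_on_compose2[OF cont])
    show "continuous_on (clipschitz K \<Delta>) (N p)"
      unfolding N_def
      by (intro continuous_on_coordinatewise_then_product continuous_on_of_real continuous_on_add
          continuous_on_divide continuous_on_const continuous_on_compose2[OF p(3) continuous_on_proj])
        (use \<open>K > 0\<close> in auto)
    show "N p ` clipschitz K \<Delta> \<subseteq> BLip_b_plus ?D"
      using N[OF _ p(1,2)] by blast
  qed
  from this[of Re] this[of Im] have
    "continuous_on (clipschitz K \<Delta>) (\<lambda>h. 2 * K * \<mu> (N Re h) + (2 * K * \<i> * \<mu> (N Im h) + - (K + K * \<i>) * \<mu> (\<lambda>x. 1)))"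
    by (intro continuous_on_add continuous_on_mult continuous_on_const)
      (auto simp: abs_Re_le_cmod abs_Im_le_cmod continuous_on_Re continuous_on_Im)
  then have "continuous_on (clipschitz K \<Delta>) \<mu>"
    by (rule continuous_on_eq) (simp add: decomp)
  then show ?thesis
    using sub continuous_on_subset by blast
qed

section \<open>Orbit functions of uniform measures\<close>

text \<open>For the classes \<open>H\<close> used below, this is the least pseudometric for which
  every orbit function \<open>\<lambda>x. \<mu> (\<lambda>z. h (z + x))\<close> with
  \<open>h \<in> H\<close> is 1-Lipschitz.\<close>

definition orbit_dist ::
    "(('a \<Rightarrow> complex) \<Rightarrow> complex) \<Rightarrow> ('a \<Rightarrow> complex) set \<Rightarrow> 'a::topological_group_add \<Rightarrow> 'a \<Rightarrow> real" where
  "orbit_dist \<mu> H x y = (SUP h\<in>H. cmod (\<mu> (\<lambda>z. h (z + x)) - \<mu> (\<lambda>z. h (z + y))))"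

text \<open>Invariance holds because right translation maps the class into itself. The substance is
  continuity: \<open>\<mu>\<close> is continuous on the class, so orbit values are jointly
  continuous in \<open>x\<close> and \<open>h\<close>, and compactness in \<open>h\<close> makes the
  supremum continuous.\<close>

lemma
  assumes "\<mu> \<in> uniform_measures" "\<Delta> \<in> RP" "0 \<le> C"
  shows orbit_dist_RP: "orbit_dist \<mu> (clipschitz C \<Delta>) \<in> RP"
    and orbit_dist_upper: "h \<in> clipschitz C \<Delta> \<Longrightarrow>
      cmod (\<mu> (\<lambda>z. h (z + x)) - \<mu> (\<lambda>z. h (z + y))) \<le> orbit_dist \<mu> (clipschitz C \<Delta>) x y"
proof -
  let ?H = "clipschitz C \<Delta>"
  let ?m = "\<lambda>h x. \<mu> (\<lambda>z. h (z + x))"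
  let ?D = "orbit_dist \<mu> ?H"
  have dual: "\<mu> \<in> LUC_dual"
    using assms(1) by (simp add: uniform_measures_def)
  have "(\<lambda>x. 0) \<in> ?H"
    using assms RP_nonneg by (auto simp: clipschitz_def)
  then have ne: "?H \<noteq> {}" by blast
  obtain B where B: "0 \<le> B" "\<And>f M. f \<in> LUC \<Longrightarrow> (\<And>x. cmod (f x) \<le> M) \<Longrightarrow> cmod (\<mu> f) \<le> B * M"
    using dual_bound[OF dual] by metis
  have bound: "cmod (?m h x) \<le> B * C" if "h \<in> ?H" for h x
    using clipschitz_right_translate[OF assms(2) that, of x] clipschitz_LUC[OF assms(2)]
    by (intro B(2)) (auto simp: clipschitz_def)
  have bdd: "bdd_above ((\<lambda>h. cmod (?m h x - ?m h y)) ` ?H)" for x y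
  proof (rule bdd_aboveI2)
    show "cmod (?m h x - ?m h y) \<le> 2 * (B * C)" if "h \<in> ?H" for h
      using bound[OF that, of x] bound[OF that, of y] norm_triangle_ineq4[of "?m h x" "?m h y"]
      by linarith
  qed
  have upper: "cmod (?m h x - ?m h y) \<le> ?D x y" if "h \<in> ?H" for h x y
    unfolding orbit_dist_def by (rule cSUP_upper[OF that bdd])
  then show "h \<in> ?H \<Longrightarrow> cmod (?m h x - ?m h y) \<le> ?D x y" for h x y .
  have least: "?D x y \<le> M" if "\<And>h. h \<in> ?H \<Longrightarrow> cmod (?m h x - ?m h y) \<le> M" for x y M
    unfolding orbit_dist_def using that ne by (intro cSUP_least) auto
  have refl: "?D x x = 0" for x
    using ne by (simp add: orbit_dist_def)
  have commute: "?D x y = ?D y x" for x y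
    by (simp add: orbit_dist_def norm_minus_commute)
  have triangle: "?D x z \<le> ?D x y + ?D y z" for x y z
  proof (rule least)
    fix h assume h: "h \<in> ?H"
    show "cmod (?m h x - ?m h z) \<le> ?D x y + ?D y z"
      using upper[OF h, of x y] upper[OF h, of y z]
        norm_triangle_ineq[of "?m h x - ?m h y" "?m h y - ?m h z"] by simp
  qed
  have nonneg: "0 \<le> ?D x y" for x y
    using triangle[of x x y] refl[of x] commute[of y x] by linarith
  have invar_le: "?D (x + z) (y + z) \<le> ?D x y" for x y z
  proof (rule least)
    fix h assume h: "h \<in> ?H"
    show "cmod (?m h (x + z) - ?m h (y + z)) \<le> ?D x y"
      using upper[OF clipschitz_right_translate[OF assms(2) h, of z], of x y]
      by (simp add: add.assoc)
  qed
  have invar: "?D (x + z) (y + z) = ?D x y" for x y z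
    using invar_le[of x z y] invar_le[of "x + z" "- z" "y + z"] by (simp add: add.assoc)
  \<comment> \<open>Evaluation at a moving point is jointly continuous because all functions in
    \<open>?H\<close> share the modulus \<open>\<Delta>\<close>: the cost of moving the point does
    not depend on the function.\<close>
  have joint: "continuous_on (UNIV \<times> ?H) (\<lambda>(x, h). ?m h x)"
  proof -
    have "continuous_on (UNIV \<times> ?H) (\<lambda>p. \<lambda>z. snd p (z + fst p))"
    proof (rule continuous_on_coordinatewise_then_product)
      fix z
      show "continuous_on (UNIV \<times> ?H) (\<lambda>p. snd p (z + fst p))"
        unfolding continuous_on_def
      proof
        fix p :: "'a \<times> ('a \<Rightarrow> complex)"
        assume "p \<in> UNIV \<times> ?H"
        have "((\<lambda>q. snd q (z + fst p)) \<longlongrightarrow> snd p (z + fst p)) (at p within UNIV \<times> ?H)"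
        proof -
          have "continuous_on (UNIV \<times> ?H) (\<lambda>q. snd q (z + fst p))"
            using continuous_on_compose2[OF continuous_on_proj[of UNIV "z + fst p"]
                continuous_on_snd[OF continuous_on_id]] by simp
          then show ?thesis
            using \<open>p \<in> _\<close> unfolding continuous_on_def by blast
        qed
        moreover have "((\<lambda>q. snd q (z + fst q) - snd q (z + fst p)) \<longlongrightarrow> 0) (at p within UNIV \<times> ?H)"
        proof (rule Lim_null_comparison)
          have "continuous_on UNIV (\<lambda>q::'a \<times> ('a \<Rightarrow> complex). \<Delta> (z + fst q) (z + fst p))"
            by (intro RP_continuous[OF assms(2)] continuous_intros)
          then show "((\<lambda>q. \<Delta> (z + fst q) (z + fst p)) \<longlongrightarrow> 0) (at p within UNIV \<times> ?H)"
            unfolding continuous_on_def using RP_refl[OF assms(2), of "z + fst p"]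
            by (metis UNIV_I tendsto_within_subset subset_UNIV)
          show "\<forall>\<^sub>F q in at p within UNIV \<times> ?H.
              cmod (snd q (z + fst q) - snd q (z + fst p)) \<le> \<Delta> (z + fst q) (z + fst p)"
            unfolding eventually_at_filter
            by (intro always_eventually) (auto simp: clipschitz_def)
        qed
        ultimately show "((\<lambda>q. snd q (z + fst q)) \<longlongrightarrow> snd p (z + fst p)) (at p within UNIV \<times> ?H)"
          using tendsto_add by fastforce
      qed
    qed
    from continuous_on_compose2[OF uniform_measure_continuous[OF assms(1,2), of C] this]
    show ?thesis
      using clipschitz_right_translate[OF assms(2)] by (simp add: case_prod_unfold image_subset_iff)
  qed
  \<comment> \<open>A tube argument over the compact \<open>?H\<close> makes the estimate uniform in
    \<open>h\<close>; the bound \<open>e / 2\<close> leaves room for a strict inequality after the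
    supremum.\<close>
  have small: "\<forall>\<^sub>F x in nhds x0. ?D x x0 < e" if e: "0 < e" for x0 e
  proof -
    obtain X where X: "x0 \<in> X" "open X" "\<forall>x\<in>X \<inter> UNIV. \<forall>h\<in>?H. dist (?m h x) (?m h x0) \<le> e / 2"
      by (rule continuous_on_prod_compactE[OF joint compact_clipschitz UNIV_I half_gt_zero[OF e], of x0])
        (use that in simp)
    have "?D x x0 \<le> e / 2" if "x \<in> X" for x
      using X(3) that by (intro least) (auto simp: dist_norm)
    then have "?D x x0 < e" if "x \<in> X" for x
      using that e by fastforce
    then show ?thesis
      using X(1,2) by (auto simp: eventually_nhds)
  qed
  have "continuous_on UNIV (\<lambda>p. ?D (fst p) (snd p))"
    unfolding continuous_on_def
  proof
    fix p :: "'a \<times> 'a"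
    show "((\<lambda>p. ?D (fst p) (snd p)) \<longlongrightarrow> ?D (fst p) (snd p)) (at p)"
      unfolding tendsto_iff
    proof (intro allI impI)
      fix e :: real assume "0 < e"
      have "\<forall>\<^sub>F q in at p. ?D (fst q) (fst p) < e / 2"
        using small[of "e / 2" "fst p"] \<open>0 < e\<close>
        by (intro eventually_compose_filterlim[OF _ tendsto_fst[OF tendsto_ident_at]]) auto
      moreover have "\<forall>\<^sub>F q in at p. ?D (snd q) (snd p) < e / 2"
        using small[of "e / 2" "snd p"] \<open>0 < e\<close>
        by (intro eventually_compose_filterlim[OF _ tendsto_snd[OF tendsto_ident_at]]) auto
      ultimately show "\<forall>\<^sub>F q in at p. dist (?D (fst q) (snd q)) (?D (fst p) (snd p)) < e"
      proof eventually_elim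
        case (elim q)
        then show ?case
          using triangle[of "fst q" "snd q" "fst p"] triangle[of "fst p" "snd q" "snd p"]
            triangle[of "fst p" "snd p" "fst q"] triangle[of "fst q" "snd p" "snd q"]
            commute[of "fst p" "fst q"] commute[of "snd p" "snd q"]
          unfolding dist_real_def abs_less_iff by linarith
      qed
    qed
  qed
  then show "?D \<in> RP"
    unfolding RP_iff using nonneg refl commute triangle invar by blast
qed

text \<open>The orbit function is bounded and 1-Lipschitz for \<open>orbit_dist\<close>, which is a
  member of \<open>RP\<close>.\<close>

lemma uniform_measure_orbit_LUC:
  assumes "\<mu> \<in> uniform_measures" "\<Delta> \<in> RP" "f \<in> clipschitz C \<Delta>"
  shows "(\<lambda>x. \<mu> (\<lambda>z. f (z + x))) \<in> LUC"
proof -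
  have "0 \<le> C"
    using assms(3) norm_ge_zero order_trans unfolding clipschitz_def by blast
  have dual: "\<mu> \<in> LUC_dual"
    using assms(1) by (simp add: uniform_measures_def)
  obtain B where B: "0 \<le> B" "\<And>f M. f \<in> LUC \<Longrightarrow> (\<And>x. cmod (f x) \<le> M) \<Longrightarrow> cmod (\<mu> f) \<le> B * M"
    using dual_bound[OF dual] by metis
  have "cmod (\<mu> (\<lambda>z. f (z + x))) \<le> B * C" for x
    using clipschitz_right_translate[OF assms(2,3), of x] clipschitz_LUC[OF assms(2)]
    by (intro B(2)) (auto simp: clipschitz_def)
  then have "(\<lambda>x. \<mu> (\<lambda>z. f (z + x))) \<in> clipschitz (B * C) (orbit_dist \<mu> (clipschitz C \<Delta>))"
    using orbit_dist_upper[OF assms(1,2) \<open>0 \<le> C\<close> assms(3)] by (simp add: clipschitz_def)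
  then show ?thesis
    using clipschitz_LUC orbit_dist_RP[OF assms(1,2) \<open>0 \<le> C\<close>] by blast
qed

text \<open>At each \<open>z\<close> the left translates by \<open>x\<close> and \<open>y\<close>
  differ by \<open>f (x + z) - f (y + z)\<close>, which right invariance bounds by
  \<open>\<Delta> x y\<close>.\<close>

lemma bullet_clipschitz:
  assumes "\<nu> \<in> LUC_dual" "0 \<le> B"
    and "\<And>f M. f \<in> LUC \<Longrightarrow> (\<And>x. cmod (f x) \<le> M) \<Longrightarrow> cmod (\<nu> f) \<le> B * M"
    and "\<Delta> \<in> RP" "f \<in> clipschitz C \<Delta>"
  shows "bullet \<nu> f \<in> clipschitz (B * C) (\<lambda>x y. B * \<Delta> x y)"
proof -
  have f: "f \<in> LUC"
    using clipschitz_LUC assms by blast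
  have "cmod (\<nu> (left_translate x f)) \<le> B * C" for x
    using assms(5) by (intro assms(3) LUC_left_translate f) (simp add: clipschitz_def left_translate_def)
  moreover have "cmod (\<nu> (left_translate x f) - \<nu> (left_translate y f)) \<le> B * \<Delta> x y" for x y
  proof -
    have "cmod (\<nu> (\<lambda>z. left_translate x f z - left_translate y f z)) \<le> B * \<Delta> x y"
    proof (intro assms(3) LUC_diff LUC_left_translate f)
      show "cmod (left_translate x f z - left_translate y f z) \<le> \<Delta> x y" for z
        using assms(5) RP_right_invariant[OF assms(4), of x z y]
        by (metis (mono_tags, lifting) clipschitz_def left_translate_def mem_Collect_eq)
    qed
    then show ?thesis
      by (simp add: dual_diff[OF assms(1)] LUC_left_translate f)
  qed
  ultimately show ?thesis
    by (simp add: clipschitz_def bullet_def)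
qed

lemma bullet_LUC:
  assumes "\<nu> \<in> LUC_dual" "f \<in> LUC"
  shows "bullet \<nu> f \<in> LUC"
proof -
  obtain B where B: "0 \<le> B" "\<And>f M. f \<in> LUC \<Longrightarrow> (\<And>x. cmod (f x) \<le> M) \<Longrightarrow> cmod (\<nu> f) \<le> B * M"
    using dual_bound[OF assms(1)] by metis
  obtain C where C: "0 \<le> C" "\<And>x. cmod (f x) \<le> C"
    using LUC_bounded[OF assms(2)] by metis
  show ?thesis
    unfolding LUC_iff
  proof (intro conjI allI impI)
    have "cmod (bullet \<nu> f x) \<le> B * C" for x
      unfolding bullet_def
      by (intro B LUC_left_translate assms) (simp add: left_translate_def C)
    then show "bounded (range (bullet \<nu> f))"
      by (auto simp: bounded_iff)
    fix \<epsilon> :: real assume "0 < \<epsilon>"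
    then have "0 < \<epsilon> / (B + 1)"
      using B(1) by simp
    then obtain \<Delta> where \<Delta>: "\<Delta> \<in> RP" "\<And>x y. \<Delta> x y < 1 \<Longrightarrow> dist (f x) (f y) < \<epsilon> / (B + 1)"
      using LUC_uniform[OF assms(2)] by metis
    have "dist (bullet \<nu> f x) (bullet \<nu> f y) < \<epsilon>" if "\<Delta> x y < 1" for x y
    proof -
      have "cmod (\<nu> (\<lambda>z. left_translate x f z - left_translate y f z)) \<le> B * (\<epsilon> / (B + 1))"
      proof (intro B LUC_diff LUC_left_translate assms)
        show "cmod (left_translate x f z - left_translate y f z) \<le> \<epsilon> / (B + 1)" for z
          using \<Delta>(2)[of "x + z" "y + z"] RP_right_invariant[OF \<Delta>(1), of x z y] that
          by (simp add: left_translate_def dist_norm)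
      qed
      also have "\<dots> < \<epsilon>"
        using B(1) \<open>0 < \<epsilon>\<close> by (simp add: field_simps)
      finally show ?thesis
        by (simp add: bullet_def dist_norm dual_diff[OF assms(1)] LUC_left_translate assms(2))
    qed
    with \<Delta>(1) show "\<exists>\<Delta>\<in>RP. \<forall>x y. \<Delta> x y < 1 \<longrightarrow> dist (bullet \<nu> f x) (bullet \<nu> f y) < \<epsilon>"
      by blast
  qed
qed

section \<open>Approximation of functionals by finitely supported measures\<close>

text \<open>This is the error allowed at stage \<open>F\<close> in the nets below that are indexed
  by finite sets; infinity of \<open>A\<close> lets the cardinalities grow.\<close>

lemma finite_subsets_at_top_card_tendsto:
  assumes "infinite A"
  shows "((\<lambda>F. inverse (real (Suc (card F)))) \<longlongrightarrow> 0) (finite_subsets_at_top A)"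
proof -
  have "filterlim card sequentially (finite_subsets_at_top A)"
    unfolding filterlim_at_top
  proof
    fix n
    obtain F where F: "finite F" "F \<subseteq> A" "card F = n"
      using infinite_arbitrarily_large[OF assms] by metis
    then have "n \<le> card G" if "finite G" "F \<subseteq> G" for G
      using card_mono[OF that] by simp
    with F show "\<forall>\<^sub>F G in finite_subsets_at_top A. n \<le> card G"
      unfolding eventually_finite_subsets_at_top by (intro exI[of _ F]) auto
  qed
  from filterlim_compose[OF LIMSEQ_inverse_real_of_nat this] show ?thesis .
qed

lemma tendsto_coordinatewise:
  fixes f :: "'b \<Rightarrow> 'c \<Rightarrow> 'd::topological_space"
  assumes "\<And>x. ((\<lambda>i. f i x) \<longlongrightarrow> l x) F"
  shows "(f \<longlongrightarrow> l) F"
proof -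
  have "limitin (product_topology (\<lambda>_. euclidean) UNIV) f l F"
    unfolding limitin_componentwise using assms by simp
  then show ?thesis
    by (simp add: euclidean_product_topology)
qed

lemma finite_net_of_bounded_functions:
  fixes \<Phi> :: "('b \<Rightarrow> complex) set"
  assumes "finite \<Phi>" "\<And>f. f \<in> \<Phi> \<Longrightarrow> bounded (range f)" "0 < \<epsilon>"
  obtains J where "finite J" "\<And>x. \<exists>y\<in>J. \<forall>f\<in>\<Phi>. cmod (f x - f y) < \<epsilon>"
proof -
  have "\<exists>C c. finite C \<and> (\<forall>x. c x \<in> C \<and> cmod (f x - c x) < \<epsilon> / 2)" if "f \<in> \<Phi>" for f
  proof -
    have "compact (closure (range f))"
      using assms(2)[OF that] by (simp add: compact_closure)
    then obtain C where C: "finite C" "closure (range f) \<subseteq> (\<Union>w\<in>C. ball w (\<epsilon> / 2))"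
      using assms(3) unfolding compact_eq_totally_bounded by (meson half_gt_zero)
    have "\<exists>w\<in>C. cmod (f x - w) < \<epsilon> / 2" for x
      using C(2) closure_subset[of "range f"] by (force simp: dist_norm norm_minus_commute)
    then obtain c where "\<And>x. c x \<in> C \<and> cmod (f x - c x) < \<epsilon> / 2"
      by metis
    with C(1) show ?thesis by blast
  qed
  then obtain C c where C: "\<And>f. f \<in> \<Phi> \<Longrightarrow> finite (C f)"
    "\<And>f x. f \<in> \<Phi> \<Longrightarrow> c f x \<in> C f \<and> cmod (f x - c f x) < \<epsilon> / 2"
    by metis
  \<comment> \<open>The code of \<open>x\<close> records, for each \<open>f\<close>, a grid value
    close to \<open>f x\<close>. Only finitely many codes occur, points with equal codes are close
    under every \<open>f\<close>, and \<open>J\<close> contains a point of each code.\<close>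
  define k where "k x = (\<lambda>f\<in>\<Phi>. c f x)" for x
  have "range k \<subseteq> PiE \<Phi> C"
    using C(2) by (auto simp: k_def)
  then have "finite (range k)"
    using finite_PiE[OF assms(1), of C] C(1) finite_subset by blast
  then obtain J where J: "finite J" "range k = k ` J"
    using finite_subset_image[of "range k" k UNIV] by auto
  show ?thesis
  proof (rule that[OF J(1)])
    fix x
    obtain y where y: "y \<in> J" "k x = k y"
      using J(2) by (metis image_iff rangeI)
    have "cmod (f x - f y) < \<epsilon>" if "f \<in> \<Phi>" for f
    proof -
      have "c f x = c f y"
        using fun_cong[OF y(2), of f] that by (simp add: k_def)
      then show ?thesis
        using C(2)[OF that, of x] C(2)[OF that, of y]
          norm_triangle_ineq4[of "f x - c f x" "f y - c f y"] by simp
    qed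
    with y(1) show "\<exists>y\<in>J. \<forall>f\<in>\<Phi>. cmod (f x - f y) < \<epsilon>" by blast
  qed
qed

text \<open>The functions \<open>\<phi>\<close> are built from the pseudometric \<open>\<Sum>f\<in>\<Phi>. \<bar>f x - f y\<bar>\<close>.\<close>

lemma LUC_partition_of_unity:
  fixes \<Phi> :: "('a::topological_group_add \<Rightarrow> complex) set"
  assumes "finite \<Phi>" "\<Phi> \<subseteq> LUC" "0 < \<epsilon>"
  obtains J and \<phi> :: "'a \<Rightarrow> 'a \<Rightarrow> real"
  where "finite J" "\<And>y. y \<in> J \<Longrightarrow> (\<lambda>x. complex_of_real (\<phi> y x)) \<in> LUC"
    "\<And>y x. 0 \<le> \<phi> y x" "\<And>x. (\<Sum>y\<in>J. \<phi> y x) = 1"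
    "\<And>y x f. f \<in> \<Phi> \<Longrightarrow> \<phi> y x \<noteq> 0 \<Longrightarrow> cmod (f x - f y) \<le> \<epsilon>"
proof -
  define d where "d x y = (\<Sum>f\<in>\<Phi>. cmod (f x - f y))" for x y :: 'a
  have d_nonneg: "0 \<le> d x y" for x y
    by (simp add: d_def sum_nonneg)
  have d_triangle: "\<bar>d x z - d y z\<bar> \<le> d x y" for x y z
  proof -
    have "\<bar>d x z - d y z\<bar> \<le> (\<Sum>f\<in>\<Phi>. \<bar>cmod (f x - f z) - cmod (f y - f z)\<bar>)"
      by (simp add: d_def sum_abs flip: sum_subtractf)
    also have "\<dots> \<le> d x y"
      unfolding d_def
    proof (rule sum_mono)
      show "\<bar>cmod (f x - f z) - cmod (f y - f z)\<bar> \<le> cmod (f x - f y)" for f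
        using norm_triangle_ineq3[of "f x - f z" "f y - f z"] by simp
    qed
    finally show ?thesis .
  qed
  have d_member: "cmod (f x - f y) \<le> d x y" if "f \<in> \<Phi>" for f x y
    unfolding d_def using assms(1) that
    by (intro member_le_sum[of f \<Phi> "\<lambda>f. cmod (f x - f y)"]) auto
  have "bounded (range f)" if "f \<in> \<Phi>" for f
    using that assms(2) LUC_iff by blast
  \<comment> \<open>\<open>card \<Phi>\<close> summands of this size add up to at most
    \<open>\<epsilon> / 2\<close>; the added 1 covers empty \<open>\<Phi>\<close>.\<close>
  moreover have "0 < \<epsilon> / (2 * (card \<Phi> + 1))"
    using assms(3) by simp
  ultimately obtain J where J: "finite J"
    "\<And>x. \<exists>y\<in>J. \<forall>f\<in>\<Phi>. cmod (f x - f y) < \<epsilon> / (2 * (card \<Phi> + 1))"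
    using finite_net_of_bounded_functions[OF assms(1)] by metis
  have net: "\<exists>y\<in>J. d x y \<le> \<epsilon> / 2" for x
  proof -
    obtain y where y: "y \<in> J" "\<And>f. f \<in> \<Phi> \<Longrightarrow> cmod (f x - f y) < \<epsilon> / (2 * (card \<Phi> + 1))"
      using J(2) by blast
    have "d x y \<le> (\<Sum>f\<in>\<Phi>. \<epsilon> / (2 * (card \<Phi> + 1)))"
      unfolding d_def using y(2) by (intro sum_mono less_imp_le)
    also have "\<dots> = \<epsilon> / 2 * (card \<Phi> / (card \<Phi> + 1))"
      by simp
    also have "\<dots> \<le> \<epsilon> / 2 * 1"
      using assms(3) by (intro mult_left_mono) auto
    finally show ?thesis using y(1) by auto
  qed
  \<comment> \<open>Tents of height \<open>\<epsilon>\<close> around the points of \<open>J\<close>,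
    to be divided by their sum. Every point is within \<open>\<epsilon> / 2\<close> of
    \<open>J\<close>, so the sum stays above \<open>\<epsilon> / 2\<close> and the quotients are
    Lipschitz for \<open>d\<close>.\<close>
  define \<psi> where "\<psi> y x = max 0 (\<epsilon> - d x y)" for x y
  define \<Psi> where "\<Psi> x = (\<Sum>y\<in>J. \<psi> y x)" for x
  define n where "n = real (card J)"
  have \<psi>: "0 \<le> \<psi> y x" "\<bar>\<psi> y x - \<psi> y x'\<bar> \<le> d x x'" "\<psi> y x \<le> \<epsilon>" for x x' y
    using d_triangle[of x y x'] d_nonneg[of x y] d_nonneg[of x x'] assms(3) by (auto simp: \<psi>_def)
  have \<Psi>: "\<epsilon> / 2 \<le> \<Psi> x" for x
  proof -
    obtain y where "y \<in> J" "d x y \<le> \<epsilon> / 2"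
      using net by blast
    then have "\<epsilon> / 2 \<le> \<psi> y x"
      unfolding \<psi>_def by linarith
    also have "\<dots> \<le> \<Psi> x"
      unfolding \<Psi>_def using J(1) \<open>y \<in> J\<close> \<psi>(1) by (intro member_le_sum[of y J "\<lambda>y. \<psi> y x"]) auto
    finally show ?thesis .
  qed
  then have \<Psi>_pos: "0 < \<Psi> x" for x
    using assms(3) half_gt_zero less_le_trans by blast
  have \<Psi>_lip: "\<bar>\<Psi> x - \<Psi> x'\<bar> \<le> n * d x x'" for x x'
  proof -
    have "\<bar>\<Psi> x - \<Psi> x'\<bar> \<le> (\<Sum>y\<in>J. \<bar>\<psi> y x - \<psi> y x'\<bar>)"
      by (simp add: \<Psi>_def sum_abs flip: sum_subtractf)
    also have "\<dots> \<le> (\<Sum>y\<in>J. d x x')"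
      by (intro sum_mono \<psi>)
    finally show ?thesis by (simp add: n_def)
  qed
  define \<phi> where "\<phi> y x = \<psi> y x / \<Psi> x" for x y
  have \<phi>_nonneg: "0 \<le> \<phi> y x" for x y
    using \<psi>(1) \<Psi>_pos[of x] by (simp add: \<phi>_def)
  have \<phi>_sum: "(\<Sum>y\<in>J. \<phi> y x) = 1" for x
    using \<Psi>_pos[of x] by (simp add: \<phi>_def flip: \<Psi>_def sum_divide_distrib)
  have \<phi>_le: "\<phi> y x \<le> 1" if "y \<in> J" for x y
    using member_le_sum[of y J "\<lambda>y. \<phi> y x"] \<phi>_nonneg J(1) that by (simp add: \<phi>_sum)
  have \<phi>_lip: "\<bar>\<phi> y x - \<phi> y x'\<bar> \<le> 2 / \<epsilon> * (1 + n) * d x x'" if "y \<in> J" for x x' y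
  proof -
    \<comment> \<open>Clearing a single denominator leaves only differences of \<open>\<psi>\<close>
      and of \<open>\<Psi>\<close>, the latter with a coefficient of at most 1.\<close>
    have "(\<phi> y x - \<phi> y x') * \<Psi> x = (\<psi> y x - \<psi> y x') - \<phi> y x' * (\<Psi> x - \<Psi> x')"
      using \<Psi>_pos[of x] \<Psi>_pos[of x'] by (simp add: \<phi>_def field_simps)
    then have "\<bar>\<phi> y x - \<phi> y x'\<bar> * \<Psi> x = \<bar>(\<psi> y x - \<psi> y x') - \<phi> y x' * (\<Psi> x - \<Psi> x')\<bar>"
      using \<Psi>_pos[of x] by (metis abs_mult abs_of_pos)
    also have "\<dots> \<le> \<bar>\<psi> y x - \<psi> y x'\<bar> + \<bar>\<phi> y x' * (\<Psi> x - \<Psi> x')\<bar>"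
      by (rule abs_triangle_ineq4)
    also have "\<dots> \<le> d x x' + 1 * (n * d x x')"
      unfolding abs_mult using \<psi>(2) \<Psi>_lip \<phi>_nonneg \<phi>_le[OF that]
      by (intro add_mono mult_mono) (auto simp: abs_of_nonneg)
    finally have "\<bar>\<phi> y x - \<phi> y x'\<bar> * \<Psi> x \<le> (1 + n) * d x x'"
      by (simp add: algebra_simps)
    moreover have "\<bar>\<phi> y x - \<phi> y x'\<bar> * (\<epsilon> / 2) \<le> \<bar>\<phi> y x - \<phi> y x'\<bar> * \<Psi> x"
      using \<Psi> by (intro mult_left_mono) auto
    ultimately show ?thesis
      using assms(3) by (simp add: field_simps)
  qed
  show ?thesis
  proof (rule that[OF J(1), of \<phi>])
    fix y assume "y \<in> J"
    show "(\<lambda>x. complex_of_real (\<phi> y x)) \<in> LUC"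
    proof (rule LUC_dominated[OF assms(1,2), of _ 1 "2 / \<epsilon> * (1 + n)"])
      show "cmod (complex_of_real (\<phi> y x)) \<le> 1" for x
        using \<phi>_le[OF \<open>y \<in> J\<close>] \<phi>_nonneg by simp
      show "cmod (complex_of_real (\<phi> y x) - complex_of_real (\<phi> y x'))
          \<le> 2 / \<epsilon> * (1 + n) * (\<Sum>f\<in>\<Phi>. cmod (f x - f x'))" for x x'
        using \<phi>_lip[OF \<open>y \<in> J\<close>, of x x'] unfolding d_def
        by (metis norm_of_real of_real_diff)
    qed
  next
    fix y x f assume "f \<in> \<Phi>" "\<phi> y x \<noteq> 0"
    then have "\<psi> y x \<noteq> 0"
      by (auto simp: \<phi>_def)
    then show "cmod (f x - f y) \<le> \<epsilon>"
      using d_member[OF \<open>f \<in> \<Phi>\<close>, of x y] by (auto simp: \<psi>_def max_def split: if_splits)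
  qed (use \<phi>_nonneg \<phi>_sum in auto)
qed

text \<open>The weights are the values of \<open>\<nu>\<close> on a partition of unity:
  \<open>f\<close> is uniformly close to the sum of the \<open>f y * \<phi> y\<close>, as it varies
  little where \<open>\<phi> y\<close> is nonzero. The mass bound \<open>B\<close> later keeps the
  approximating net bounded.\<close>

lemma molecular_approximation:
  fixes \<nu> :: "('a::topological_group_add \<Rightarrow> complex) \<Rightarrow> complex"
  assumes "\<nu> \<in> LUC_dual" "0 \<le> B"
    and B: "\<And>f M. f \<in> LUC \<Longrightarrow> (\<And>x. cmod (f x) \<le> M) \<Longrightarrow> cmod (\<nu> f) \<le> B * M"
    and "finite \<Phi>" "\<Phi> \<subseteq> LUC" "0 < \<epsilon>"
  obtains J and c :: "'a \<Rightarrow> complex" where "finite J" "(\<Sum>y\<in>J. cmod (c y)) \<le> B"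
    "\<And>f. f \<in> \<Phi> \<Longrightarrow> cmod ((\<Sum>y\<in>J. c y * f y) - \<nu> f) \<le> \<epsilon>"
proof -
  have "0 < \<epsilon> / (B + 1)"
    using assms by simp
  from LUC_partition_of_unity[OF assms(4,5) this] obtain J and \<phi> :: "'a \<Rightarrow> 'a \<Rightarrow> real"
    where J: "finite J" and \<phi>: "\<And>y. y \<in> J \<Longrightarrow> (\<lambda>x. complex_of_real (\<phi> y x)) \<in> LUC"
      "\<And>y x. 0 \<le> \<phi> y x" "\<And>x. (\<Sum>y\<in>J. \<phi> y x) = 1"
      "\<And>y x f. f \<in> \<Phi> \<Longrightarrow> \<phi> y x \<noteq> 0 \<Longrightarrow> cmod (f x - f y) \<le> \<epsilon> / (B + 1)"
    by metis
  define c where "c y = \<nu> (\<lambda>x. complex_of_real (\<phi> y x))" for y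
  \<comment> \<open>Unimodular factors, or 0 where \<open>c y = 0\<close>, that turn the total mass
    into the value of \<open>\<nu>\<close> at a function bounded by 1.\<close>
  define s where "s y = cnj (sgn (c y))" for y
  have s: "s y * c y = cmod (c y)" "cmod (s y) \<le> 1" for y
    by (simp_all add: s_def sgn_eq complex_norm_square[symmetric] power2_eq_square norm_divide
        mult.commute[of "cnj _"])
  have "(\<Sum>y\<in>J. cmod (c y)) \<le> B"
  proof -
    have "cmod (\<nu> (\<lambda>x. \<Sum>y\<in>J. s y * complex_of_real (\<phi> y x))) \<le> B * 1"
    proof (intro B LUC_sum LUC_cmult \<phi>)
      fix x
      have "cmod (\<Sum>y\<in>J. s y * complex_of_real (\<phi> y x)) \<le> (\<Sum>y\<in>J. \<phi> y x)"
        using s(2) \<phi>(2) by (intro sum_norm_le) (auto simp: norm_mult intro: mult_left_le_one_le)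
      then show "cmod (\<Sum>y\<in>J. s y * complex_of_real (\<phi> y x)) \<le> 1"
        by (simp add: \<phi>(3))
    qed
    moreover have "\<nu> (\<lambda>x. \<Sum>y\<in>J. s y * complex_of_real (\<phi> y x)) = complex_of_real (\<Sum>y\<in>J. cmod (c y))"
      by (subst dual_sum[OF assms(1) J]) (use \<phi>(1) in \<open>auto simp: s(1) simp flip: c_def\<close>)
    ultimately show ?thesis
      by (simp add: sum_nonneg del: of_real_sum)
  qed
  moreover have "cmod ((\<Sum>y\<in>J. c y * f y) - \<nu> f) \<le> \<epsilon>" if f: "f \<in> \<Phi>" for f
  proof -
    have fL: "f \<in> LUC" using f assms(5) by blast
    have gL: "(\<lambda>x. \<Sum>y\<in>J. f y * complex_of_real (\<phi> y x)) \<in> LUC"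
      by (intro LUC_sum LUC_cmult \<phi>)
    have "\<nu> (\<lambda>x. \<Sum>y\<in>J. f y * complex_of_real (\<phi> y x)) = (\<Sum>y\<in>J. c y * f y)"
      by (subst dual_sum[OF assms(1) J]) (use \<phi>(1) in \<open>auto simp: mult.commute simp flip: c_def\<close>)
    then have "(\<Sum>y\<in>J. c y * f y) - \<nu> f = \<nu> (\<lambda>x. (\<Sum>y\<in>J. f y * complex_of_real (\<phi> y x)) - f x)"
      by (simp add: dual_diff[OF assms(1) gL fL])
    moreover have "cmod (\<nu> (\<lambda>x. (\<Sum>y\<in>J. f y * complex_of_real (\<phi> y x)) - f x)) \<le> B * (\<epsilon> / (B + 1))"
    proof (intro B LUC_diff gL fL)
      fix x
      have "f x = (\<Sum>y\<in>J. f x * complex_of_real (\<phi> y x))"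
        using \<phi>(3)[of x] by (simp flip: sum_distrib_left of_real_sum)
      then have "(\<Sum>y\<in>J. f y * complex_of_real (\<phi> y x)) - f x =
          (\<Sum>y\<in>J. (f y - f x) * complex_of_real (\<phi> y x))"
        by (simp add: left_diff_distrib sum_subtractf)
      also have "cmod \<dots> \<le> (\<Sum>y\<in>J. \<epsilon> / (B + 1) * \<phi> y x)"
      proof (rule sum_norm_le)
        fix y
        show "cmod ((f y - f x) * complex_of_real (\<phi> y x)) \<le> \<epsilon> / (B + 1) * \<phi> y x"
          using \<phi>(4)[OF f, of y x] \<phi>(2)[of y x]
          by (cases "\<phi> y x = 0")
            (auto simp: norm_mult norm_minus_commute simp del: times_divide_eq_left intro: mult_right_mono)
      qed
      also have "\<dots> = \<epsilon> / (B + 1)"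
        by (subst sum_distrib_left[symmetric]) (simp add: \<phi>(3))
      finally show "cmod ((\<Sum>y\<in>J. f y * complex_of_real (\<phi> y x)) - f x) \<le> \<epsilon> / (B + 1)" .
    qed
    moreover have "B * (\<epsilon> / (B + 1)) \<le> \<epsilon>"
      using assms(2,6) by (simp add: field_simps)
    ultimately show ?thesis by simp
  qed
  ultimately show ?thesis
    using that[OF J, of c] by blast
qed

section \<open>Exchanging a uniform measure with an arbitrary functional\<close>

text \<open>For finitely supported \<open>\<nu>\<close> the equation is linearity of
  \<open>\<mu>\<close>. The approximants have mass at most \<open>B\<close>, so their
  \<open>bullet\<close> functions stay in one class \<open>?H\<close> on which \<open>\<mu>\<close>
  is pointwise continuous; the other side converges because the orbit function lies in
  \<open>LUC\<close>.\<close>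

lemma uniform_measure_bullet_lipschitz:
  fixes \<mu> \<nu> :: "('a::topological_group_add \<Rightarrow> complex) \<Rightarrow> complex"
  assumes "\<mu> \<in> uniform_measures" "\<nu> \<in> LUC_dual" "\<Delta> \<in> RP" "f \<in> clipschitz C \<Delta>"
  shows "\<mu> (bullet \<nu> f) = \<nu> (\<lambda>x. \<mu> (\<lambda>z. f (z + x)))"
proof -
  let ?F = "finite_subsets_at_top (LUC :: ('a \<Rightarrow> complex) set)"
  have dual: "\<mu> \<in> LUC_dual"
    using assms(1) by (simp add: uniform_measures_def)
  have fL: "f \<in> LUC"
    using clipschitz_LUC assms(3,4) by blast
  obtain B where B: "0 \<le> B" "\<And>f M. f \<in> LUC \<Longrightarrow> (\<And>x. cmod (f x) \<le> M) \<Longrightarrow> cmod (\<nu> f) \<le> B * M"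
    using dual_bound[OF assms(2)] by metis
  let ?H = "clipschitz (B * C) (\<lambda>x y. B * \<Delta> x y)"
  \<comment> \<open>The constants show that \<open>LUC\<close> is infinite, so the errors allowed
    along its finite subsets tend to 0.\<close>
  have "inj (\<lambda>(c::complex) (x::'a). c)"
    by (auto simp: inj_def fun_eq_iff)
  then have "infinite (range (\<lambda>(c::complex) (x::'a). c))"
    using finite_imageD infinite_UNIV_char_0 by blast
  moreover have "range (\<lambda>(c::complex) (x::'a). c) \<subseteq> LUC"
    using LUC_const by blast
  ultimately have inf: "infinite (LUC :: ('a \<Rightarrow> complex) set)"
    using finite_subset by blast
  define Q where "Q \<Phi> J c \<longleftrightarrow> finite J \<and> (\<Sum>y\<in>J. cmod (c y)) \<le> B \<and>
      (\<forall>h\<in>\<Phi>. cmod ((\<Sum>y\<in>J. c y * h y) - \<nu> h) \<le> inverse (real (Suc (card \<Phi>))))"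
    for \<Phi> and J :: "'a set" and c
  have "\<exists>J c. Q \<Phi> J c" if "finite \<Phi>" "\<Phi> \<subseteq> LUC" for \<Phi>
    by (rule molecular_approximation[OF assms(2) B that, of "inverse (real (Suc (card \<Phi>)))"])
      (auto simp: Q_def)
  then obtain J c where "\<And>\<Phi>. finite \<Phi> \<Longrightarrow> \<Phi> \<subseteq> LUC \<Longrightarrow> Q \<Phi> (J \<Phi>) (c \<Phi>)"
    by metis
  then have J: "\<And>\<Phi>. finite \<Phi> \<Longrightarrow> \<Phi> \<subseteq> LUC \<Longrightarrow> finite (J \<Phi>)"
    "\<And>\<Phi>. finite \<Phi> \<Longrightarrow> \<Phi> \<subseteq> LUC \<Longrightarrow> (\<Sum>y\<in>J \<Phi>. cmod (c \<Phi> y)) \<le> B"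
    "\<And>\<Phi> h. finite \<Phi> \<Longrightarrow> \<Phi> \<subseteq> LUC \<Longrightarrow> h \<in> \<Phi> \<Longrightarrow>
      cmod ((\<Sum>y\<in>J \<Phi>. c \<Phi> y * h y) - \<nu> h) \<le> inverse (real (Suc (card \<Phi>)))"
    by (auto simp: Q_def)
  have conv: "((\<lambda>\<Phi>. \<Sum>y\<in>J \<Phi>. c \<Phi> y * h y) \<longlongrightarrow> \<nu> h) ?F" if "h \<in> LUC" for h
  proof (rule LIM_zero_cancel, rule Lim_null_comparison)
    show "\<forall>\<^sub>F \<Phi> in ?F. cmod ((\<Sum>y\<in>J \<Phi>. c \<Phi> y * h y) - \<nu> h) \<le> inverse (real (Suc (card \<Phi>)))"
      unfolding eventually_finite_subsets_at_top
      using J(3) that by (intro exI[of _ "{h}"]) auto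
  qed (rule finite_subsets_at_top_card_tendsto[OF inf])
  let ?b = "\<lambda>\<Phi> x. \<Sum>y\<in>J \<Phi>. c \<Phi> y * f (x + y)"
  have lim: "(?b \<longlongrightarrow> bullet \<nu> f) ?F"
  proof (rule tendsto_coordinatewise)
    show "((\<lambda>\<Phi>. ?b \<Phi> x) \<longlongrightarrow> bullet \<nu> f x) ?F" for x
      using conv[OF LUC_left_translate[OF fL, of x]] by (simp add: bullet_def left_translate_def)
  qed
  have mem: "?b \<Phi> \<in> ?H" if "finite \<Phi>" "\<Phi> \<subseteq> LUC" for \<Phi>
  proof -
    have "cmod (?b \<Phi> x) \<le> B * C" for x
    proof -
      have "cmod (?b \<Phi> x) \<le> (\<Sum>y\<in>J \<Phi>. cmod (c \<Phi> y) * C)"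
        using assms(4) by (intro sum_norm_le) (auto simp: norm_mult clipschitz_def intro: mult_left_mono)
      also have "\<dots> \<le> B * C"
        using J(2)[OF that] assms(4) norm_ge_zero[THEN order_trans, of _ C]
        by (auto simp: clipschitz_def intro!: mult_right_mono simp flip: sum_distrib_right)
      finally show ?thesis .
    qed
    moreover have "cmod (?b \<Phi> x - ?b \<Phi> x') \<le> B * \<Delta> x x'" for x x'
    proof -
      have "?b \<Phi> x - ?b \<Phi> x' = (\<Sum>y\<in>J \<Phi>. c \<Phi> y * (f (x + y) - f (x' + y)))"
        by (simp add: sum_subtractf right_diff_distrib)
      also have "cmod \<dots> \<le> (\<Sum>y\<in>J \<Phi>. cmod (c \<Phi> y) * \<Delta> x x')"
      proof (rule sum_norm_le)
        show "cmod (c \<Phi> y * (f (x + y) - f (x' + y))) \<le> cmod (c \<Phi> y) * \<Delta> x x'" for y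
          using assms(4) RP_right_invariant[OF assms(3), of x y x']
          unfolding norm_mult clipschitz_def by (intro mult_left_mono) (auto, metis)
      qed
      also have "\<dots> \<le> B * \<Delta> x x'"
        using J(2)[OF that] RP_nonneg[OF assms(3), of x x']
        by (simp add: mult_right_mono flip: sum_distrib_right)
      finally show ?thesis .
    qed
    ultimately show ?thesis
      by (simp add: clipschitz_def)
  qed
  have fin: "\<forall>\<^sub>F \<Phi> in ?F. finite \<Phi> \<and> \<Phi> \<subseteq> LUC"
    unfolding eventually_finite_subsets_at_top by (intro exI[of _ "{}"]) auto
  have "((\<lambda>\<Phi>. \<mu> (?b \<Phi>)) \<longlongrightarrow> \<mu> (bullet \<nu> f)) ?F"
  proof (rule continuous_on_tendsto_compose[OF uniform_measure_continuous[OF assms(1)] lim])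
    show "(\<lambda>x y. B * \<Delta> x y) \<in> RP"
      by (rule RP_scale[OF assms(3) B(1)])
    show "bullet \<nu> f \<in> ?H"
      by (rule bullet_clipschitz[OF assms(2) B assms(3,4)])
    show "\<forall>\<^sub>F \<Phi> in ?F. ?b \<Phi> \<in> ?H"
      using fin by eventually_elim (use mem in blast)
  qed
  moreover have "((\<lambda>\<Phi>. \<mu> (?b \<Phi>)) \<longlongrightarrow> \<nu> (\<lambda>x. \<mu> (\<lambda>z. f (z + x)))) ?F"
  proof (rule Lim_transform_eventually[OF conv[OF uniform_measure_orbit_LUC[OF assms(1,3,4)]]])
    show "\<forall>\<^sub>F \<Phi> in ?F. (\<Sum>y\<in>J \<Phi>. c \<Phi> y * \<mu> (\<lambda>z. f (z + y))) = \<mu> (?b \<Phi>)"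
      using fin
    proof eventually_elim
      case (elim \<Phi>)
      then show ?case
        using J(1) clipschitz_right_translate[OF assms(3,4)] clipschitz_LUC[OF assms(3)]
        by (subst dual_sum[OF dual]) auto
    qed
  qed
  ultimately show ?thesis
    by (rule tendsto_unique[OF finite_subsets_at_top_neq_bot])
qed

section \<open>Density of the Lipschitz functions\<close>

text \<open>The infimal convolution of \<open>f\<close> with \<open>2 * M * \<Delta>\<close>. A
  point \<open>y\<close> with \<open>\<Delta> x y \<ge> 1\<close> pays at least
  \<open>2 * M\<close>, the largest possible oscillation of \<open>f\<close>, so only points of the
  unit ball around \<open>x\<close> can push the infimum below \<open>f x\<close>.\<close>

lemma LUC_lipschitz_approximation_real:
  fixes f :: "'a::topological_group_add \<Rightarrow> real"
  assumes "\<And>x. \<bar>f x\<bar> \<le> M" "\<Delta> \<in> RP" "\<And>x y. \<Delta> x y < 1 \<Longrightarrow> \<bar>f x - f y\<bar> < \<epsilon>"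
  obtains g where "\<And>x. \<bar>g x\<bar> \<le> M" "\<And>x y. \<bar>g x - g y\<bar> \<le> 2 * M * \<Delta> x y" "\<And>x. \<bar>f x - g x\<bar> \<le> \<epsilon>"
proof -
  have M: "0 \<le> M"
    using assms(1)[of undefined] by linarith
  define g where "g x = (INF y. f y + 2 * M * \<Delta> x y)" for x
  have lower: "- M \<le> f y + 2 * M * \<Delta> x y" for x y
    using assms(1)[of y] M RP_nonneg[OF assms(2), of x y] mult_nonneg_nonneg[of "2 * M" "\<Delta> x y"]
    by linarith
  then have bdd: "bdd_below (range (\<lambda>y. f y + 2 * M * \<Delta> x y))" for x
    by (intro bdd_belowI2)
  have g_le: "g x \<le> f y + 2 * M * \<Delta> x y" for x y
    unfolding g_def by (rule cINF_lower[OF bdd]) simp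
  have g_ge: "r \<le> g x" if "\<And>y. r \<le> f y + 2 * M * \<Delta> x y" for r x
    unfolding g_def using that by (intro cINF_greatest) auto
  have g_le_f: "g x \<le> f x" for x
    using g_le[of x x] by (simp add: RP_refl[OF assms(2)])
  show ?thesis
  proof (rule that[of g])
    show "\<bar>g x\<bar> \<le> M" for x
      using g_le_f[of x] g_ge[of "- M" x] lower assms(1)[of x] by (simp add: abs_le_iff)
    have "g x - 2 * M * \<Delta> x y \<le> g y" for x y
    proof (rule g_ge)
      fix z
      have "M * \<Delta> x z \<le> M * (\<Delta> x y + \<Delta> y z)"
        by (intro mult_left_mono M RP_triangle assms)
      then show "g x - 2 * M * \<Delta> x y \<le> f z + 2 * M * \<Delta> y z"
        using g_le[of x z] by (simp add: algebra_simps)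
    qed
    from this[of x y for x y] show "\<bar>g x - g y\<bar> \<le> 2 * M * \<Delta> x y" for x y
      using RP_commute[OF assms(2), of x y] by (smt (verit))
    have "f x - \<epsilon> \<le> g x" for x
    proof (rule g_ge)
      fix y
      show "f x - \<epsilon> \<le> f y + 2 * M * \<Delta> x y"
      proof (cases "\<Delta> x y < 1")
        case True
        then show ?thesis
          using assms(3)[OF True] M RP_nonneg[OF assms(2), of x y]
            mult_nonneg_nonneg[of "2 * M" "\<Delta> x y"] by linarith
      next
        case False
        then have "2 * M * 1 \<le> 2 * M * \<Delta> x y"
          using M by (intro mult_left_mono) auto
        moreover have "0 < \<epsilon>"
          using assms(3)[of x x] by (simp add: RP_refl[OF assms(2)])
        ultimately show ?thesis
          using assms(1)[of x] assms(1)[of y] by linarith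
      qed
    qed
    then show "\<bar>f x - g x\<bar> \<le> \<epsilon>" for x
      using g_le_f[of x] by (smt (verit))
  qed
qed

lemma LUC_lipschitz_approximation:
  fixes f :: "'a::topological_group_add \<Rightarrow> complex"
  assumes "f \<in> LUC" "0 < \<epsilon>"
  obtains C \<Delta> g where "\<Delta> \<in> RP" "g \<in> clipschitz C \<Delta>" "\<And>x. cmod (f x - g x) \<le> \<epsilon>"
proof -
  obtain M where M: "0 \<le> M" "\<And>x. cmod (f x) \<le> M"
    using LUC_bounded[OF assms(1)] by metis
  obtain \<Delta> where \<Delta>: "\<Delta> \<in> RP" "\<And>x y. \<Delta> x y < 1 \<Longrightarrow> dist (f x) (f y) < \<epsilon> / 2"
    using LUC_uniform[OF assms(1), of "\<epsilon> / 2"] assms(2) by auto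
  have part: "\<exists>u. (\<forall>x. \<bar>u x\<bar> \<le> M) \<and> (\<forall>x y. \<bar>u x - u y\<bar> \<le> 2 * M * \<Delta> x y) \<and>
      (\<forall>x. \<bar>p (f x) - u x\<bar> \<le> \<epsilon> / 2)"
    if p: "\<And>z. \<bar>p z\<bar> \<le> cmod z" "\<And>z w. p (z - w) = p z - p w" for p :: "complex \<Rightarrow> real"
  proof (rule LUC_lipschitz_approximation_real[of "\<lambda>x. p (f x)" M \<Delta> "\<epsilon> / 2"])
    show "\<bar>p (f x)\<bar> \<le> M" for x
      using p(1)[of "f x"] M(2)[of x] by linarith
    show "\<bar>p (f x) - p (f y)\<bar> < \<epsilon> / 2" if "\<Delta> x y < 1" for x y
      using p(1)[of "f x - f y"] \<Delta>(2)[OF that] unfolding p(2) dist_norm by linarith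
  qed (use \<Delta>(1) in blast)+
  obtain u where u: "\<And>x. \<bar>u x\<bar> \<le> M" "\<And>x y. \<bar>u x - u y\<bar> \<le> 2 * M * \<Delta> x y"
    "\<And>x. \<bar>Re (f x) - u x\<bar> \<le> \<epsilon> / 2"
    using part[of Re, OF abs_Re_le_cmod minus_complex.simps(1)] by blast
  obtain v where v: "\<And>x. \<bar>v x\<bar> \<le> M" "\<And>x y. \<bar>v x - v y\<bar> \<le> 2 * M * \<Delta> x y"
    "\<And>x. \<bar>Im (f x) - v x\<bar> \<le> \<epsilon> / 2"
    using part[of Im, OF abs_Im_le_cmod minus_complex.simps(2)] by blast
  show ?thesis
  proof (rule that[of "\<lambda>x y. 4 * M * \<Delta> x y" "\<lambda>x. Complex (u x) (v x)" "2 * M"])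
    show "(\<lambda>x y. 4 * M * \<Delta> x y) \<in> RP"
      using M(1) by (intro RP_scale \<Delta>(1)) auto
    show "(\<lambda>x. Complex (u x) (v x)) \<in> clipschitz (2 * M) (\<lambda>x y. 4 * M * \<Delta> x y)"
      unfolding clipschitz_def
    proof (intro CollectI conjI allI)
      show "cmod (Complex (u x) (v x)) \<le> 2 * M" for x
        using cmod_le[of "Complex (u x) (v x)"] u(1)[of x] v(1)[of x] by simp
      show "cmod (Complex (u x) (v x) - Complex (u y) (v y)) \<le> 4 * M * \<Delta> x y" for x y
        using cmod_le[of "Complex (u x) (v x) - Complex (u y) (v y)"] u(2)[of x y] v(2)[of x y]
        by simp
    qed
    show "cmod (f x - Complex (u x) (v x)) \<le> \<epsilon>" for x
      using cmod_le[of "f x - Complex (u x) (v x)"] u(3)[of x] v(3)[of x] by simp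
  qed
qed

lemma LUC_right_translate:
  assumes "f \<in> LUC"
  shows "(\<lambda>z. f (z + x)) \<in> LUC"
  unfolding LUC_iff
proof (intro conjI allI impI)
  obtain C where "\<And>x. cmod (f x) \<le> C"
    using LUC_bounded[OF assms] by metis
  then show "bounded (range (\<lambda>z. f (z + x)))"
    by (auto simp: bounded_iff)
  fix \<epsilon> :: real assume "0 < \<epsilon>"
  then obtain \<Delta> where \<Delta>: "\<Delta> \<in> RP" "\<And>x y. \<Delta> x y < 1 \<Longrightarrow> dist (f x) (f y) < \<epsilon>"
    using LUC_uniform[OF assms] by metis
  have "dist (f (y + x)) (f (z + x)) < \<epsilon>" if "\<Delta> y z < 1" for y z
    using that \<Delta>(2) RP_right_invariant[OF \<Delta>(1)] by simp
  with \<Delta>(1) show "\<exists>\<Delta>\<in>RP. \<forall>y z. \<Delta> y z < 1 \<longrightarrow> dist (f (y + x)) (f (z + x)) < \<epsilon>"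
    by blast
qed

lemma bullet_diff:
  assumes "\<nu> \<in> LUC_dual" "f \<in> LUC" "g \<in> LUC"
  shows "bullet \<nu> f x - bullet \<nu> g x = \<nu> (\<lambda>y. left_translate x f y - left_translate x g y)"
  unfolding bullet_def by (rule dual_diff[symmetric]) (intro assms LUC_left_translate)+

text \<open>Both sides are Lipschitz in \<open>f\<close> for the supremum norm, so the identity
  passes from the dense Lipschitz functions to \<open>LUC\<close>; the orbit function stays in
  \<open>LUC\<close> as a uniform limit.\<close>

lemma uniform_measure_bullet:
  assumes "\<mu> \<in> uniform_measures" "f \<in> LUC" and \<nu>: "\<nu> \<in> LUC_dual"
  shows "\<mu> (bullet \<nu> f) = \<nu> (\<lambda>x. \<mu> (\<lambda>z. f (z + x)))"
proof -
  let ?o = "\<lambda>f x. \<mu> (\<lambda>z. f (z + x))"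
  have dual: "\<mu> \<in> LUC_dual"
    using assms(1) by (simp add: uniform_measures_def)
  obtain B where B: "0 \<le> B" "\<And>f M. f \<in> LUC \<Longrightarrow> (\<And>x. cmod (f x) \<le> M) \<Longrightarrow> cmod (\<mu> f) \<le> B * M"
    using dual_bound[OF dual] by metis
  have close: "cmod (?o f x - ?o g x) \<le> B * \<delta>" if "g \<in> LUC" "\<And>x. cmod (f x - g x) \<le> \<delta>" for g x \<delta>
    using that by (subst dual_diff[OF dual, symmetric])
      (auto intro!: B LUC_diff LUC_right_translate assms)
  have orb: "?o f \<in> LUC"
  proof (rule LUC_uniform_limit)
    fix \<epsilon> :: real assume "0 < \<epsilon>"
    then have "0 < \<epsilon> / (B + 1)"
      using B(1) by simp
    then obtain C \<Delta> g where g: "\<Delta> \<in> RP" "g \<in> clipschitz C \<Delta>" "\<And>x. cmod (f x - g x) \<le> \<epsilon> / (B + 1)"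
      using LUC_lipschitz_approximation[OF assms(2)] by metis
    have "B * (\<epsilon> / (B + 1)) \<le> \<epsilon>"
      using B(1) \<open>0 < \<epsilon>\<close> by (simp add: field_simps)
    then have "cmod (?o f x - ?o g x) \<le> \<epsilon>" for x
      using close[OF clipschitz_LUC[OF g(1,2)] g(3), of x] by linarith
    with uniform_measure_orbit_LUC[OF assms(1) g(1,2)]
    show "\<exists>h\<in>LUC. \<forall>x. cmod (?o f x - h x) \<le> \<epsilon>"
      by (intro bexI[of _ "?o g"] allI)
  qed
  obtain B' where B': "0 \<le> B'" "\<And>f M. f \<in> LUC \<Longrightarrow> (\<And>x. cmod (f x) \<le> M) \<Longrightarrow> cmod (\<nu> f) \<le> B' * M"
    using dual_bound[OF \<nu>] by metis
  have "cmod (\<mu> (bullet \<nu> f) - \<nu> (?o f)) \<le> \<epsilon>" if "0 < \<epsilon>" for \<epsilon>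
  proof -
    \<comment> \<open>Each of the two replacements of \<open>f\<close> by \<open>g\<close> costs
      \<open>B * B' * \<delta>\<close>; the summand 1 guards against
      \<open>B * B' = 0\<close>.\<close>
    define \<delta> where "\<delta> = \<epsilon> / (2 * B * B' + 1)"
    have "0 < \<delta>"
      using B(1) B'(1) that by (simp add: \<delta>_def add_nonneg_pos)
    then obtain C \<Delta> g where g: "\<Delta> \<in> RP" "g \<in> clipschitz C \<Delta>" "\<And>x. cmod (f x - g x) \<le> \<delta>"
      using LUC_lipschitz_approximation[OF assms(2)] by metis
    have gL: "g \<in> LUC"
      by (rule clipschitz_LUC[OF g(1,2)])
    have orb_g: "?o g \<in> LUC"
      by (rule uniform_measure_orbit_LUC[OF assms(1) g(1,2)])
    have le1: "cmod (\<mu> (bullet \<nu> f) - \<mu> (bullet \<nu> g)) \<le> B * (B' * \<delta>)"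
      unfolding dual_diff[OF dual bullet_LUC[OF \<nu> assms(2)] bullet_LUC[OF \<nu> gL], symmetric]
    proof (intro B LUC_diff bullet_LUC \<nu> assms gL)
      show "cmod (bullet \<nu> f x - bullet \<nu> g x) \<le> B' * \<delta>" for x
        unfolding bullet_diff[OF \<nu> assms(2) gL] left_translate_def
        by (intro B' LUC_diff LUC_left_translate[unfolded left_translate_def] assms gL g)
    qed
    have le2: "cmod (\<nu> (?o f) - \<nu> (?o g)) \<le> B' * (B * \<delta>)"
      unfolding dual_diff[OF \<nu> orb orb_g, symmetric]
      by (intro B' LUC_diff orb orb_g close gL g)
    have "\<mu> (bullet \<nu> g) = \<nu> (?o g)"
      by (rule uniform_measure_bullet_lipschitz[OF assms(1) \<nu> g(1,2)])
    then have "\<mu> (bullet \<nu> f) - \<nu> (?o f) =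
        (\<mu> (bullet \<nu> f) - \<mu> (bullet \<nu> g)) - (\<nu> (?o f) - \<nu> (?o g))"
      by simp
    then have "cmod (\<mu> (bullet \<nu> f) - \<nu> (?o f)) \<le> B * (B' * \<delta>) + B' * (B * \<delta>)"
      by (simp only: order_trans[OF norm_triangle_ineq4 add_mono[OF le1 le2]])
    also have "\<dots> = (2 * B * B') * \<delta>"
      by (simp add: algebra_simps)
    also have "\<dots> \<le> (2 * B * B' + 1) * \<delta>"
      using \<open>0 < \<delta>\<close> by (intro mult_right_mono) auto
    also have "\<dots> = \<epsilon>"
      using add_nonneg_pos[of "2 * B * B'" 1] B(1) B'(1) by (simp add: \<delta>_def)
    finally show ?thesis .
  qed
  then have "cmod (\<mu> (bullet \<nu> f) - \<nu> (?o f)) \<le> 0"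
    by (rule field_le_epsilon) (simp only: add_0)
  then show "\<mu> (bullet \<nu> f) = \<nu> (?o f)"
    by simp
qed

section \<open>The weak-star topology\<close>

text \<open>Coordinates outside \<open>LUC\<close> are constantly \<open>undefined\<close> on the
  dual, so adding them does not refine the topology. Continuity and compactness can then be handled
  with the type-class notions.\<close>

lemma weak_star_eq: "weak_star = top_of_set LUC_dual"
proof -
  let ?P = "product_topology (\<lambda>_. euclidean) LUC :: (('a \<Rightarrow> complex) \<Rightarrow> complex) topology"
  have sub: "LUC_dual \<subseteq> (extensional LUC :: (('a \<Rightarrow> complex) \<Rightarrow> complex) set)"
    using dual_extensional by blast
  then have top: "topspace (subtopology ?P LUC_dual) = LUC_dual"
    by (auto simp: PiE_def)
  have 1: "continuous_map (top_of_set LUC_dual) (subtopology ?P LUC_dual) id"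
    unfolding continuous_map_in_subtopology continuous_map_componentwise
    using sub by (auto intro: continuous_on_proj)
  have "continuous_map (subtopology ?P LUC_dual) (product_topology (\<lambda>_. euclidean) UNIV) id"
    unfolding continuous_map_componentwise_UNIV
  proof
    fix f :: "'a \<Rightarrow> complex"
    show "continuous_map (subtopology ?P LUC_dual) euclidean (\<lambda>\<mu>. id \<mu> f)"
    proof (cases "f \<in> LUC")
      case True
      then show ?thesis
        by (simp, intro continuous_map_from_subtopology continuous_map_product_coordinates True)
    next
      case False
      have "continuous_map (subtopology ?P LUC_dual) euclidean (\<lambda>\<mu>. undefined :: complex)"
        by simp
      then show ?thesis
        by (rule continuous_map_eq) (use False sub top in \<open>auto simp: extensional_def\<close>)
    qed
  qed
  then have 2: "continuous_map (subtopology ?P LUC_dual) (top_of_set LUC_dual) id"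
    by (auto simp: continuous_map_in_subtopology euclidean_product_topology)
  have "openin (subtopology ?P LUC_dual) T = openin (top_of_set LUC_dual) T" for T
    using topology_finer_continuous_id[of "subtopology ?P LUC_dual" "top_of_set LUC_dual"]
      topology_finer_continuous_id[of "top_of_set LUC_dual" "subtopology ?P LUC_dual"] 1 2 top
    by auto
  then show ?thesis
    unfolding weak_star_def topology_eq by blast
qed

lemma subtopology_weak_star:
  assumes "S \<subseteq> LUC_dual"
  shows "subtopology weak_star S = top_of_set S"
  using assms by (simp add: weak_star_eq subtopology_subtopology Int_absorb1)

lemma convolution_apply: "f \<in> LUC \<Longrightarrow> (\<mu> \<star> \<nu>) f = \<mu> (bullet \<nu> f)"
  by (simp add: convolution_def)

text \<open>By the exchange formula, coordinate \<open>f\<close> of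
  \<open>\<mu> \<star> \<nu>\<close> is \<open>\<nu>\<close> evaluated at a function independent of
  \<open>\<nu>\<close>, hence a coordinate projection.\<close>

lemma uniform_measure_left_mult_continuous:
  assumes "subsemigroup_LUC_dual S" "\<mu> \<in> uniform_measures" "\<mu> \<in> S" "\<nu>\<^sub>0 \<in> S"
  shows "left_mult_continuous_at S \<mu> \<nu>\<^sub>0"
proof -
  have S: "S \<subseteq> LUC_dual" "\<And>\<nu>. \<nu> \<in> S \<Longrightarrow> \<mu> \<star> \<nu> \<in> S"
    using assms by (auto simp: subsemigroup_LUC_dual_def)
  have "continuous_on S (\<lambda>\<nu>. \<mu> \<star> \<nu>)"
  proof (rule continuous_on_coordinatewise_then_product)
    fix f :: "'a \<Rightarrow> complex"
    show "continuous_on S (\<lambda>\<nu>. (\<mu> \<star> \<nu>) f)"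
    proof (cases "f \<in> LUC")
      case True
      have "continuous_on S (\<lambda>\<nu>. \<nu> (\<lambda>x. \<mu> (\<lambda>z. f (z + x))))"
        by (rule continuous_on_proj)
      then show ?thesis
        by (rule continuous_on_eq)
          (use S(1) True uniform_measure_bullet[OF assms(2) True] in \<open>auto simp: convolution_apply\<close>)
    qed (simp add: convolution_def)
  qed
  then have "continuous_map (top_of_set S) (top_of_set S) (\<lambda>\<nu>. \<mu> \<star> \<nu>)"
    using S(2) by (simp add: continuous_map_in_subtopology Pi_iff)
  then show ?thesis
    using assms(4) unfolding left_mult_continuous_at_def subtopology_weak_star[OF S(1)]
    by (simp add: continuous_map_eq_topcontinuous_at)
qed

text \<open>Extracts a single coordinate as an eventuality in \<open>nhds \<nu>\<^sub>0\<close>, a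
  form that can be combined with the filter of a cluster point.\<close>

lemma left_mult_continuous_atD:
  assumes "S \<subseteq> LUC_dual" "left_mult_continuous_at S \<mu> \<nu>\<^sub>0" "f \<in> LUC" "0 < \<epsilon>"
  shows "\<forall>\<^sub>F \<nu> in nhds \<nu>\<^sub>0. \<nu> \<in> S \<longrightarrow> cmod (\<mu> (bullet \<nu> f) - \<mu> (bullet \<nu>\<^sub>0 f)) < \<epsilon>"
proof -
  have cont: "topcontinuous_at (top_of_set S) (top_of_set S) (\<lambda>\<nu>. \<mu> \<star> \<nu>) \<nu>\<^sub>0"
    using assms(1,2) by (simp add: left_mult_continuous_at_def subtopology_weak_star)
  define V where "V = {\<xi>. cmod (\<xi> f - \<mu> (bullet \<nu>\<^sub>0 f)) < \<epsilon>}"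
  have "open V"
    unfolding V_def
    by (intro open_Collect_less continuous_on_norm continuous_on_diff continuous_on_proj continuous_on_const)
  then have "openin (top_of_set S) (S \<inter> V)"
    by (rule openin_open_Int)
  moreover have "\<nu>\<^sub>0 \<in> S" "\<mu> \<star> \<nu>\<^sub>0 \<in> S"
    using cont by (auto simp: topcontinuous_at_def)
  moreover have "\<mu> \<star> \<nu>\<^sub>0 \<in> V"
    using assms(3,4) by (simp add: V_def convolution_apply)
  ultimately obtain U where U: "openin (top_of_set S) U" "\<nu>\<^sub>0 \<in> U" "\<And>\<nu>. \<nu> \<in> U \<Longrightarrow> \<mu> \<star> \<nu> \<in> S \<inter> V"
    using cont[unfolded topcontinuous_at_def, THEN conjunct2, THEN conjunct2, rule_format, of "S \<inter> V"]
    by (metis IntI)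
  then obtain T where T: "open T" "U = S \<inter> T"
    by (auto simp: openin_open)
  have "cmod (\<mu> (bullet \<nu> f) - \<mu> (bullet \<nu>\<^sub>0 f)) < \<epsilon>" if "\<nu> \<in> T" "\<nu> \<in> S" for \<nu>
    using U(3)[of \<nu>] that assms(3) by (simp add: T V_def convolution_apply)
  then show ?thesis
    using T U(2) by (auto simp: eventually_nhds)
qed

section \<open>Compactness of the uniform compactification\<close>

text \<open>Extensionality is spelled out function by function, so that every clause is visibly a
  closed condition on coordinates.\<close>

definition dual_unit_ball :: "(('a::topological_group_add \<Rightarrow> complex) \<Rightarrow> complex) set" where
  "dual_unit_ball = {\<mu>. (\<forall>f. f \<notin> LUC \<longrightarrow> \<mu> f = undefined) \<and>
     (\<forall>f\<in>LUC. \<forall>g\<in>LUC. \<mu> (\<lambda>x. f x + g x) = \<mu> f + \<mu> g) \<and>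
     (\<forall>c. \<forall>f\<in>LUC. \<mu> (\<lambda>x. c * f x) = c * \<mu> f) \<and>
     (\<forall>f\<in>LUC. cmod (\<mu> f) \<le> (SUP x. cmod (f x)))}"

lemma dual_unit_ball_subset: "dual_unit_ball \<subseteq> LUC_dual"
proof
  fix \<mu> :: "('a \<Rightarrow> complex) \<Rightarrow> complex" assume "\<mu> \<in> dual_unit_ball"
  moreover from this have "\<exists>C. \<forall>f\<in>LUC. cmod (\<mu> f) \<le> C * (SUP x. cmod (f x))"
    unfolding dual_unit_ball_def by (intro exI[of _ 1]) simp
  ultimately show "\<mu> \<in> LUC_dual"
    unfolding dual_unit_ball_def LUC_dual_def extensional_def by blast
qed

lemma closed_dual_unit_ball: "closed dual_unit_ball"
  unfolding dual_unit_ball_def Ball_def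
  by (intro closed_Collect_conj closed_Collect_all closed_Collect_imp open_Collect_const
      closed_Collect_le closed_Collect_eq continuous_on_norm continuous_on_add
      continuous_on_mult continuous_on_proj continuous_on_const)

text \<open>Banach-Alaoglu: a closed subset of a product of compact factors, discs on
  \<open>LUC\<close> and a single point elsewhere.\<close>

lemma compact_dual_unit_ball:
  "compact (dual_unit_ball :: (('a::topological_group_add \<Rightarrow> complex) \<Rightarrow> complex) set)"
proof -
  let ?R = "\<lambda>f :: 'a \<Rightarrow> complex. if f \<in> LUC then cball 0 (SUP x. cmod (f x)) else {undefined :: complex}"
  have "compactin (product_topology (\<lambda>_. euclidean) UNIV) (PiE UNIV ?R)"
    by (subst compactin_PiE) auto
  then have "compact (PiE UNIV ?R)"
    by (simp add: euclidean_product_topology)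
  from compact_Int_closed[OF this closed_dual_unit_ball]
  have "compact (PiE UNIV ?R \<inter> dual_unit_ball)" .
  moreover have "PiE UNIV ?R \<inter> dual_unit_ball = dual_unit_ball"
    by (auto simp: dual_unit_ball_def)
  ultimately show ?thesis by simp
qed

lemma range_point_eval_subset: "range point_eval \<subseteq> dual_unit_ball"
proof
  fix \<mu> :: "('a \<Rightarrow> complex) \<Rightarrow> complex" assume "\<mu> \<in> range point_eval"
  then obtain x where x: "\<mu> = point_eval x" by blast
  have "cmod (f x) \<le> (SUP x. cmod (f x))" if f: "f \<in> LUC" for f :: "'a \<Rightarrow> complex"
  proof -
    obtain C where "\<And>x. cmod (f x) \<le> C"
      using LUC_bounded[OF f] by metis
    then show ?thesis
      by (intro cSUP_upper bdd_aboveI2) auto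
  qed
  then show "\<mu> \<in> dual_unit_ball"
    unfolding x dual_unit_ball_def point_eval_def by (auto simp: LUC_add LUC_cmult)
qed

text \<open>The weak-star closure is the closure in the function type cut down to the dual. The cut
  removes nothing, since the unit ball is closed, lies in the dual and contains all point
  evaluations.\<close>

lemma uniform_compactification_eq:
  "uniform_compactification =
    (closure (range point_eval) :: (('a::topological_group_add \<Rightarrow> complex) \<Rightarrow> complex) set)"
proof -
  have "closure (range point_eval) \<subseteq> (dual_unit_ball :: (('a \<Rightarrow> complex) \<Rightarrow> complex) set)"
    by (rule closure_minimal[OF range_point_eval_subset closed_dual_unit_ball])
  moreover have "LUC_dual \<inter> range point_eval = (range point_eval :: (('a \<Rightarrow> complex) \<Rightarrow> complex) set)"
    using range_point_eval_subset dual_unit_ball_subset by blast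
  ultimately show ?thesis
    unfolding uniform_compactification_def weak_star_eq closure_of_subtopology euclidean_closure_of
    using dual_unit_ball_subset by auto
qed

lemma uniform_compactification_subset: "uniform_compactification \<subseteq> dual_unit_ball"
  unfolding uniform_compactification_eq
  by (rule closure_minimal[OF range_point_eval_subset closed_dual_unit_ball])

lemma compact_uniform_compactification:
  "compact (uniform_compactification :: (('a::topological_group_add \<Rightarrow> complex) \<Rightarrow> complex) set)"
  using compact_Int_closed[OF compact_dual_unit_ball
      closed_closure[of "range point_eval :: (('a \<Rightarrow> complex) \<Rightarrow> complex) set"]]
    uniform_compactification_subset[where 'a = 'a]
  by (simp add: uniform_compactification_eq Int_absorb1)

text \<open>Properness of the infimum of the two filters says that \<open>\<nu>\<close> is a cluster
  point of \<open>e\<close> along \<open>F\<close>; compactness provides one.\<close>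

lemma uniform_compactification_cluster_point:
  assumes "F \<noteq> bot" "\<And>i. e i \<in> uniform_compactification"
  obtains \<nu> where "\<nu> \<in> uniform_compactification" "inf (nhds \<nu>) (filtermap e F) \<noteq> bot"
proof -
  have "filtermap e F \<noteq> bot" "\<forall>\<^sub>F \<nu> in filtermap e F. \<nu> \<in> uniform_compactification"
    using assms by (auto simp: filtermap_bot_iff eventually_filtermap)
  then show ?thesis
    using compact_uniform_compactification that unfolding compact_filter by blast
qed

text \<open>The evaluation at \<open>f\<close> has both limits along the same proper filter. This
  computes cluster points wherever the net converges.\<close>

lemma cluster_point_coordinate:
  fixes e :: "'b \<Rightarrow> 'c \<Rightarrow> 'd::t2_space"
  assumes "inf (nhds \<nu>) (filtermap e F) \<noteq> bot" "((\<lambda>i. e i f) \<longlongrightarrow> l) F"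
  shows "\<nu> f = l"
proof (rule tendsto_unique[OF assms(1)])
  have "((\<lambda>\<xi>. \<xi> f) \<longlongrightarrow> \<nu> f) (nhds \<nu>)"
  proof -
    have "continuous_on UNIV (\<lambda>\<xi> :: 'c \<Rightarrow> 'd. \<xi> f)"
      by simp
    then show ?thesis
      using tendsto_at_iff_tendsto_nhds[of "\<lambda>\<xi>. \<xi> f" \<nu>] by (simp add: continuous_on_def)
  qed
  then show "((\<lambda>\<xi>. \<xi> f) \<longlongrightarrow> \<nu> f) (inf (nhds \<nu>) (filtermap e F))"
    by (rule tendsto_mono[rotated]) simp
  have "((\<lambda>\<xi>. \<xi> f) \<longlongrightarrow> l) (filtermap e F)"
    using assms(2) by (simp add: filterlim_filtermap)
  then show "((\<lambda>\<xi>. \<xi> f) \<longlongrightarrow> l) (inf (nhds \<nu>) (filtermap e F))"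
    by (rule tendsto_mono[rotated]) simp
qed

section \<open>Covering numbers and separated families\<close>

lemma card_of_finite_ordLess:
  assumes "infinite (Field \<kappa>)" "Card_order \<kappa>" "finite A"
  shows "|A| <o \<kappa>"
  using finite_ordLess_infinite[OF card_of_Well_order card_order_on_well_order_on[OF assms(2)]] assms(1,3)
  by (simp add: Field_card_of)

text \<open>Sets of size \<open>Suc n\<close> arise by inserting a point into a set of size
  \<open>n\<close>, so each layer has at most \<open>|K|\<close> members, and there are countably
  many layers.\<close>

lemma card_of_Fpow_ordLeq:
  assumes "infinite K"
  shows "|{F. F \<subseteq> K \<and> finite F}| \<le>o |K|"
proof -
  have le: "|{F. F \<subseteq> K \<and> finite F \<and> card F = n}| \<le>o |K|" for n
  proof (induction n)
    case 0
    have "{F. F \<subseteq> K \<and> finite F \<and> card F = 0} = {{}}"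
      by auto
    moreover have "|{{}}| \<le>o |K|"
      using assms by (intro ordLess_imp_ordLeq card_of_finite_ordLess) (auto simp: Field_card_of card_of_card_order_on)
    ultimately show ?case by simp
  next
    case (Suc n)
    let ?P = "K \<times> {F. F \<subseteq> K \<and> finite F \<and> card F = n}"
    have "{F. F \<subseteq> K \<and> finite F \<and> card F = Suc n} \<subseteq> (\<lambda>(x, F). insert x F) ` ?P"
      by (auto simp: image_def card_Suc_eq) blast
    then have "|{F. F \<subseteq> K \<and> finite F \<and> card F = Suc n}| \<le>o |?P|"
      by (rule surj_imp_ordLeq)
    moreover have "|?P| \<le>o |K|"
      using assms Suc by (intro card_of_Times_ordLeq_infinite_Field) (auto simp: Field_card_of card_of_refl ordIso_imp_ordLeq card_of_card_order_on)
    ultimately show ?case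
      by (rule ordLeq_transitive)
  qed
  have "{F. F \<subseteq> K \<and> finite F} = (\<Union>n. {F. F \<subseteq> K \<and> finite F \<and> card F = n})"
    by auto
  then show ?thesis
    using card_of_UNION_ordLeq_infinite[OF assms, of UNIV "\<lambda>n. {F. F \<subseteq> K \<and> finite F \<and> card F = n}"] le
      assms infinite_iff_card_of_nat[of K] by simp
qed

text \<open>If one set is infinite, the product is no larger than the disjoint sum, and such sums
  stay below an infinite cardinal.\<close>

lemma card_of_Times_ordLess:
  assumes "infinite (Field \<kappa>)" "Card_order \<kappa>" "|A| <o \<kappa>" "|B| <o \<kappa>"
  shows "|A \<times> B| <o \<kappa>"
proof (cases "finite A \<and> finite B")
  case True
  then show ?thesis
    by (intro card_of_finite_ordLess assms) auto
next
  case False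
  then have inf: "infinite (A <+> B)"
    by simp
  have "|A \<times> B| \<le>o |A <+> B|"
    using inf by (intro card_of_Times_ordLeq_infinite_Field)
      (auto simp: Field_card_of card_of_Plus1 card_of_Plus2 card_of_card_order_on)
  then show ?thesis
    using card_of_Plus_ordLess_infinite_Field[OF assms] ordLeq_ordLess_trans by blast
qed

lemma card_of_image_ordLess: "|A| <o \<kappa> \<Longrightarrow> |f ` A| <o \<kappa>"
  using card_of_image ordLeq_ordLess_trans by blast

text \<open>
  B. H. Neumann's covering argument. It yields a covering by right translates of one ball, although the
  sets \<open>{t. a + t \<in> \<dots>}\<close> involve balls for different conjugates of \<open>\<Delta>\<close>: if the set for \<open>a\<close> is not already
  large, then a right translate of it misses it and is therefore covered by the sets for the other points.
\<close>

lemma neumann_covering: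
  fixes \<kappa> :: "'k rel" and \<Delta> :: "'a::topological_group_add \<Rightarrow> 'a \<Rightarrow> real"
  assumes \<kappa>: "infinite (Field \<kappa>)" "Card_order \<kappa>" and \<Delta>: "\<Delta> \<in> RP" and "finite Q"
    and "\<And>a. a \<in> Q \<Longrightarrow> |T a| <o \<kappa>"
    and "\<And>t. \<exists>a\<in>Q. \<exists>s\<in>T a. \<Delta> (a + t) s < 1 / 2"
  shows "\<exists>A. |A| <o \<kappa> \<and> (\<forall>x. \<exists>s\<in>A. \<Delta> x s < 1)"
  using assms(4-6)
proof (induction Q arbitrary: T rule: finite_induct)
  case empty
  then show ?case by auto
next
  case (insert a Q)
  show ?case
  proof (cases "\<exists>x. \<forall>s\<in>T a. \<Delta> (a + x) s \<ge> 1")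
    case False
    have "\<exists>s\<in>T a. \<Delta> x s < 1" for x
    proof -
      have "\<not> (\<forall>s\<in>T a. \<Delta> (a + (- a + x)) s \<ge> 1)"
        using False by blast
      then show ?thesis
        by (auto simp: not_le simp flip: add.assoc)
    qed
    then show ?thesis
      using insert.prems(1)[of a] by blast
  next
    case True
    then obtain x where x: "\<And>s. s \<in> T a \<Longrightarrow> \<Delta> (a + x) s \<ge> 1"
      by blast
    \<comment> \<open>The right translation carrying \<open>s\<close> to \<open>a + x\<close>
      carries \<open>s' - x - a + s\<close> to \<open>s'\<close>, so these points pull the ball
      around \<open>s'\<close> back.\<close>
    define T' where "T' b = T b \<union> (\<lambda>(s', s). s' - x - a + s) ` (T b \<times> T a)" for b
    have "|T' b| <o \<kappa>" if "b \<in> Q" for b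
      unfolding T'_def using that insert.prems(1)
      by (intro card_of_Un_ordLess_infinite_Field \<kappa> card_of_image_ordLess card_of_Times_ordLess) auto
    moreover have "\<exists>b\<in>Q. \<exists>s\<in>T' b. \<Delta> (b + t) s < 1 / 2" for t
    proof (cases "\<exists>s\<in>T a. \<Delta> (a + t) s < 1 / 2")
      case False
      then show ?thesis
        using insert.prems(2)[of t] unfolding T'_def by blast
    next
      case True
      then obtain s where s: "s \<in> T a" "\<Delta> (a + t) s < 1 / 2"
        by blast
      \<comment> \<open>The same right translation takes \<open>a + t\<close> to
        \<open>a + t'\<close> and \<open>b + t\<close> to \<open>b + t'\<close>. It brings
        \<open>a + t'\<close> within 1/2 of \<open>a + x\<close>, which has distance at least 1 from
        \<open>T a\<close>, so some other \<open>b\<close> must cover \<open>t'\<close>.\<close>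
      define t' where "t' = t - s + a + x"
      have "a + t' = (a + t) + (- s + (a + x))"
        unfolding t'_def diff_conv_add_uminus by (simp only: add.assoc)
      moreover have "a + x = s + (- s + (a + x))"
        by (simp flip: add.assoc)
      ultimately have "\<Delta> (a + t') (a + x) < 1 / 2"
        using RP_right_invariant[OF \<Delta>, of "a + t" "- s + (a + x)" s] s(2) by metis
      then have "\<not> \<Delta> (a + t') s' < 1 / 2" if "s' \<in> T a" for s'
        using x[OF that] RP_triangle[OF \<Delta>, of "a + x" s' "a + t'"] RP_commute[OF \<Delta>, of "a + x" "a + t'"]
        by linarith
      then obtain b s' where b: "b \<in> Q" "s' \<in> T b" "\<Delta> (b + t') s' < 1 / 2"
        using insert.prems(2)[of t'] by blast
      have "b + t' = (b + t) + (- s + (a + x))"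
        unfolding t'_def diff_conv_add_uminus by (simp only: add.assoc)
      moreover have "s' = (s' - x - a + s) + (- s + (a + x))"
        by (simp flip: add.assoc)
      ultimately have "\<Delta> (b + t) (s' - x - a + s) < 1 / 2"
        using RP_right_invariant[OF \<Delta>, of "b + t" "- s + (a + x)" "s' - x - a + s"] b(3) by metis
      moreover have "s' - x - a + s \<in> T' b"
        unfolding T'_def using b(2) s(1) by force
      ultimately show ?thesis
        using b(1) by blast
    qed
    ultimately show ?thesis
      by (rule insert.IH)
  qed
qed

lemma unit_ball_plus_iff:
  assumes "\<Delta> \<in> RP"
  shows "unit_ball \<Delta> + A = UNIV \<longleftrightarrow> (\<forall>x. \<exists>s\<in>A. \<Delta> x s < 1)"
proof -
  have "x \<in> unit_ball \<Delta> + A \<longleftrightarrow> (\<exists>s\<in>A. \<Delta> x s < 1)" for x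
  proof
    assume "x \<in> unit_ball \<Delta> + A"
    then obtain u s where "u \<in> unit_ball \<Delta>" "s \<in> A" "x = u + s"
      by (auto simp: set_plus_def)
    then show "\<exists>s\<in>A. \<Delta> x s < 1"
      using RP_right_invariant[OF assms, of u s 0] RP_commute[OF assms, of 0 u]
      by (intro bexI[of _ s]) (auto simp: unit_ball_def)
  next
    assume "\<exists>s\<in>A. \<Delta> x s < 1"
    then obtain s where s: "s \<in> A" "\<Delta> x s < 1"
      by blast
    then have "x - s \<in> unit_ball \<Delta>"
      using RP_right_invariant[OF assms, of "x - s" s 0] RP_commute[OF assms, of 0 "x - s"]
      by (simp add: unit_ball_def)
    then have "(x - s) + s \<in> unit_ball \<Delta> + A"
      using s(1) by (rule set_plus_intro)
    then show "x \<in> unit_ball \<Delta> + A"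
      by simp
  qed
  then show ?thesis by auto
qed

lemma unit_ball_zero_interior:
  assumes "\<Delta> \<in> RP"
  shows "0 \<in> interior (unit_ball \<Delta>)"
proof -
  have "open (unit_ball \<Delta>)"
    unfolding unit_ball_def
    by (intro open_Collect_less RP_continuous[OF assms] continuous_on_const continuous_on_id)
  then show ?thesis
    using RP_refl[OF assms, of 0] by (simp add: interior_open unit_ball_def)
qed

section \<open>Separated families from the cardinal hypothesis\<close>

text \<open>The lower bound for \<open>\<Delta>\<^sub>0\<close> produces separated points; the upper
  bound for all pseudometrics lets nets be indexed by the finite subsets of
  \<open>Field \<kappa>\<close>. That both hold for one cardinal is what the hypothesis on
  \<open>\<Delta>\<^sub>0\<close> contributes.\<close>

locale ball_covering =
  fixes \<kappa> :: "('a::topological_group_add + nat) rel" and \<Delta>\<^sub>0 :: "'a \<Rightarrow> 'a \<Rightarrow> real"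
  assumes \<kappa>: "infinite (Field \<kappa>)" "Card_order \<kappa>"
    and \<Delta>\<^sub>0: "\<Delta>\<^sub>0 \<in> RP"
    and cover_large: "\<And>A :: 'a set. (\<forall>x. \<exists>s\<in>A. \<Delta>\<^sub>0 x s < 1) \<Longrightarrow> \<kappa> \<le>o |A|"
    and cover_small: "\<And>\<Delta> :: 'a \<Rightarrow> 'a \<Rightarrow> real. \<Delta> \<in> RP \<Longrightarrow> \<exists>A :: 'a set. |A| \<le>o \<kappa> \<and> (\<forall>x. \<exists>s\<in>A. \<Delta> x s < 1)"

lemma ball_covering_boundedness_number:
  assumes "\<Delta>\<^sub>0 \<in> RP" "eta_sharp \<Delta>\<^sub>0 =o boundedness_number TYPE('a::topological_group_add)"
  shows "ball_covering (boundedness_number TYPE('a)) \<Delta>\<^sub>0"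
proof -
  let ?\<kappa> = "boundedness_number TYPE('a)"
  have \<kappa>: "Card_order ?\<kappa>" "cinfinite ?\<kappa>" "card_bounded TYPE('a) ?\<kappa>"
    using boundedness_number_is_least[where ?'a = 'a] by (auto simp: is_least_cardinal_def)
  show ?thesis
  proof
    show "infinite (Field ?\<kappa>)" "Card_order ?\<kappa>" "\<Delta>\<^sub>0 \<in> RP"
      using \<kappa> assms(1) by (auto simp: cinfinite_def)
    show "\<exists>A. |A| \<le>o ?\<kappa> \<and> (\<forall>x. \<exists>s\<in>A. \<Delta> x s < 1)" if "\<Delta> \<in> RP" for \<Delta> :: "'a \<Rightarrow> 'a \<Rightarrow> real"
      using \<kappa>(3) unit_ball_zero_interior[OF that] unfolding card_bounded_def
      by (metis unit_ball_plus_iff[OF that])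
    fix A :: "'a set"
    assume A: "\<forall>x. \<exists>s\<in>A. \<Delta>\<^sub>0 x s < 1"
    \<comment> \<open>\<open>eta_sharp\<close> is minimal among cardinals on
      \<open>'a + nat\<close>, so minimality is applied to a copy of \<open>A\<close> in that
      type.\<close>
    let ?A = "Inl ` A :: ('a + nat) set"
    have iso: "|A| =o |?A|"
      unfolding card_of_ordIso[symmetric] by (rule exI[of _ Inl]) (auto simp: bij_betw_def)
    have "unit_ball \<Delta>\<^sub>0 + A = UNIV"
      using A unit_ball_plus_iff[OF assms(1)] by blast
    with iso have "eta_sharp \<Delta>\<^sub>0 \<le>o |?A|"
      using eta_sharp_is_least[OF assms(1)] card_of_Card_order[of ?A]
      unfolding is_least_cardinal_def by blast
    then have "eta_sharp \<Delta>\<^sub>0 \<le>o |A|"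
      using iso ordIso_symmetric ordLeq_ordIso_trans by blast
    then show "?\<kappa> \<le>o |A|"
      using assms(2) ordIso_symmetric ordIso_ordLeq_trans by blast
  qed
qed

context ball_covering
begin

abbreviation "K \<equiv> Field \<kappa>"

lemma card_K: "|K| =o \<kappa>"
  by (rule card_of_Field_ordIso[OF \<kappa>(2)])

text \<open>Otherwise \<open>neumann_covering\<close>, with the same \<open>T\<close> for every
  \<open>a\<close>, covers the group by fewer than \<open>\<kappa>\<close> unit balls of
  \<open>\<Delta>\<^sub>0\<close>.\<close>

lemma separated_point:
  assumes "finite Q" "|T| <o \<kappa>"
  shows "\<exists>t. \<forall>a\<in>Q. \<forall>s\<in>T. \<Delta>\<^sub>0 (a + t) s \<ge> 1 / 2"
proof (rule ccontr)
  assume "\<not> ?thesis"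
  then have "\<exists>a\<in>Q. \<exists>s\<in>T. \<Delta>\<^sub>0 (a + t) s < 1 / 2" for t
    by (meson not_le)
  then obtain A where "|A| <o \<kappa>" "\<forall>x. \<exists>s\<in>A. \<Delta>\<^sub>0 x s < 1"
    using neumann_covering[OF \<kappa> \<Delta>\<^sub>0 assms(1), of "\<lambda>_. T"] assms(2) by blast
  then show False
    using cover_large not_ordLess_ordLeq by blast
qed

text \<open>The union over \<open>n\<close> of the centres of covers by balls of radius
  \<open>1 / Suc n\<close>, at most \<open>\<kappa>\<close> for each \<open>n\<close>.\<close>

lemma dense_family:
  fixes \<Delta> :: "'a \<Rightarrow> 'a \<Rightarrow> real"
  assumes "\<Delta> \<in> RP"
  obtains b where "\<And>x \<epsilon>. 0 < \<epsilon> \<Longrightarrow> \<exists>\<alpha>\<in>K. \<Delta> x (b \<alpha>) < \<epsilon>"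
proof -
  have "\<exists>A. |A| \<le>o \<kappa> \<and> (\<forall>x. \<exists>s\<in>A. real (Suc n) * \<Delta> x s < 1)" for n
    using cover_small[OF RP_scale[OF assms, of "real (Suc n)"]] by simp
  then obtain A where A: "\<And>n. |A n| \<le>o \<kappa>" "\<And>n x. \<exists>s\<in>A n. real (Suc n) * \<Delta> x s < 1"
    by metis
  have nat: "|UNIV :: nat set| \<le>o \<kappa>"
    using \<kappa>(1) infinite_iff_card_of_nat[of K] ordLeq_ordIso_trans[OF _ card_K] by blast
  have "|\<Union>(range A)| \<le>o \<kappa>"
    using A(1) by (intro card_of_UNION_ordLeq_infinite_Field \<kappa> nat) auto
  then have "|\<Union>(range A)| \<le>o |K|"
    using ordIso_symmetric[OF card_K] ordLeq_ordIso_trans by blast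
  moreover have "\<Union>(range A) \<noteq> {}"
    using A(2)[of 0 0] by blast
  ultimately obtain b where b: "b ` K = \<Union>(range A)"
    using card_of_ordLeq2 by metis
  show ?thesis
  proof (rule that[of b])
    fix x and \<epsilon> :: real assume "0 < \<epsilon>"
    then obtain n where n: "inverse (real (Suc n)) < \<epsilon>"
      using reals_Archimedean by blast
    obtain s where s: "s \<in> A n" "real (Suc n) * \<Delta> x s < 1"
      using A(2) by blast
    have "\<Delta> x s < inverse (real (Suc n))"
      using s(2) by (simp add: field_simps)
    with n have "\<Delta> x s < \<epsilon>" by simp
    moreover have "s \<in> b ` K"
      using s(1) b by blast
    ultimately show "\<exists>\<alpha>\<in>K. \<Delta> x (b \<alpha>) < \<epsilon>" by blast
  qed
qed

definition Fin :: "('a + nat) set set" where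
  "Fin = {F. F \<subseteq> K \<and> finite F}"

text \<open>Transfinite recursion along a well-order of \<open>Fin \<times> Fin\<close> of cardinal
  type. Each stage has fewer than \<open>\<kappa>\<close> predecessors, each contributing finitely
  many points, so \<open>separated_point\<close> yields the next value.\<close>

lemma separated_family:
  fixes a :: "'a + nat \<Rightarrow> 'a"
  obtains t where "\<And>i j \<alpha> \<beta>. i \<in> Fin \<times> Fin \<Longrightarrow> j \<in> Fin \<times> Fin \<Longrightarrow> i \<noteq> j \<Longrightarrow> \<alpha> \<in> snd i \<Longrightarrow> \<beta> \<in> snd j \<Longrightarrow>
    \<Delta>\<^sub>0 (a \<alpha> + t i) (a \<beta> + t j) \<ge> 1 / 2"
proof -
  let ?I = "Fin \<times> Fin"
  let ?r = "|?I|"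
  let ?R = "?r - Id"
  have wo: "Well_order ?r"
    by (rule card_of_Well_order)
  then have wf: "wf ?R"
    by (simp add: well_order_on_def)
  have Fin: "|Fin| \<le>o \<kappa>"
    unfolding Fin_def using card_of_Fpow_ordLeq[OF \<kappa>(1)] card_K ordLeq_ordIso_trans by blast
  then have I: "?r \<le>o \<kappa>"
    by (intro card_of_Times_ordLeq_infinite_Field \<kappa>)
  let ?T = "\<lambda>t i. \<Union>j\<in>underS ?r i. (\<lambda>\<alpha>. a \<alpha> + t j) ` snd j"
  have T: "|?T t i| <o \<kappa>" if "i \<in> ?I" for t i
  proof -
    have U: "|underS ?r i| <o \<kappa>"
    proof -
      have "i \<in> Field ?r"
        using that by (simp only: Field_card_of)
      from card_of_underS[OF card_of_Card_order this] show ?thesis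
        using I ordLess_ordLeq_trans by blast
    qed
    have fin: "finite ((\<lambda>\<alpha>. a \<alpha> + t j) ` snd j)" if "j \<in> underS ?r i" for j
    proof -
      have "j \<in> ?I"
        using underS_Field[OF that] by (simp only: Field_card_of)
      then show ?thesis
        by (auto simp: Fin_def)
    qed
    show ?thesis
    proof (cases "finite (underS ?r i)")
      case True
      then have "finite (?T t i)"
        using fin by blast
      then show ?thesis
        by (intro card_of_finite_ordLess \<kappa>)
    next
      case False
      have "|?T t i| \<le>o |underS ?r i|"
      proof (rule card_of_UNION_ordLeq_infinite[OF False ordIso_imp_ordLeq[OF card_of_refl]], rule ballI)
        fix j assume "j \<in> underS ?r i"
        from fin[OF this] show "|(\<lambda>\<alpha>. a \<alpha> + t j) ` snd j| \<le>o |underS ?r i|"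
          using False by (intro ordLess_imp_ordLeq card_of_finite_ordLess)
            (auto simp: Field_card_of card_of_card_order_on)
      qed
      then show ?thesis
        using U by (rule ordLeq_ordLess_trans)
    qed
  qed
  \<comment> \<open>The recursion runs over the whole type, so the requirement is void outside the
    index set.\<close>
  let ?P = "\<lambda>t i x. i \<in> ?I \<longrightarrow> (\<forall>b\<in>a ` snd i. \<forall>s\<in>?T t i. \<Delta>\<^sub>0 (b + x) s \<ge> 1 / 2)"
  have "\<exists>t. \<forall>i. ?P t i (t i)"
  proof (rule dependent_wf_choice[OF wf])
    fix f g :: "('a + nat) set \<times> ('a + nat) set \<Rightarrow> 'a" and i x
    assume "\<And>j. (j, i) \<in> ?R \<Longrightarrow> f j = g j"
    then have "f j = g j" if "j \<in> underS ?r i" for j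
      using that by (auto simp: underS_def)
    then have "?T f i = ?T g i"
      by auto
    then show "?P f i x = ?P g i x"
      by simp
  next
    fix i f
    show "\<exists>x. ?P f i x"
    proof (cases "i \<in> ?I")
      case True
      then have "finite (a ` snd i)"
        by (auto simp: Fin_def)
      then show ?thesis
        using separated_point[OF _ T[OF True, of f]] by blast
    qed auto
  qed
  then obtain t where t: "\<And>i. ?P t i (t i)"
    by blast
  have less: "\<Delta>\<^sub>0 (a \<alpha> + t i) (a \<beta> + t j) \<ge> 1 / 2"
    if "(j, i) \<in> ?r" "i \<in> ?I" "i \<noteq> j" "\<alpha> \<in> snd i" "\<beta> \<in> snd j" for i j \<alpha> \<beta>
  proof -
    have "j \<in> underS ?r i"
      using that by (auto simp: underS_def)
    then have "a \<beta> + t j \<in> ?T t i"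
      using that(5) by blast
    then show ?thesis
      using t[of i] that by blast
  qed
  show ?thesis
  proof (rule that[of t])
    fix i j \<alpha> \<beta>
    assume ij: "i \<in> ?I" "j \<in> ?I" "i \<noteq> j" "\<alpha> \<in> snd i" "\<beta> \<in> snd j"
    have "total_on (Field ?r) ?r"
      using wo by (simp add: well_order_on_def linear_order_on_def)
    then have "(i, j) \<in> ?r \<or> (j, i) \<in> ?r"
      using ij(1-3) unfolding total_on_def Field_card_of by blast
    then show "\<Delta>\<^sub>0 (a \<alpha> + t i) (a \<beta> + t j) \<ge> 1 / 2"
      using less[of j i \<alpha> \<beta>] less[of i j \<beta> \<alpha>] ij RP_commute[OF \<Delta>\<^sub>0, of "a \<alpha> + t i"] by metis
  qed
qed

end

section \<open>The determining point\<close>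

lemma SUP_lipschitz:
  fixes g :: "'i \<Rightarrow> 'b \<Rightarrow> real"
  assumes "J \<noteq> {}" "\<And>j x. j \<in> J \<Longrightarrow> \<bar>g j x\<bar> \<le> M"
    and "\<And>j x y. j \<in> J \<Longrightarrow> \<bar>g j x - g j y\<bar> \<le> D x y"
  shows "\<bar>(SUP j\<in>J. g j x) - (SUP j\<in>J. g j y)\<bar> \<le> D x y"
proof -
  have bdd: "bdd_above ((\<lambda>j. g j x) ` J)" for x
    using assms(2) abs_le_D1 by (intro bdd_aboveI2[where M = M]) blast
  have le: "(SUP j\<in>J. g j x) - d \<le> (SUP j\<in>J. g j y)"
    if "\<And>j. j \<in> J \<Longrightarrow> g j x - g j y \<le> d" for x y d
  proof -
    have "(SUP j\<in>J. g j x) \<le> (SUP j\<in>J. g j y) + d"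
    proof (rule cSUP_least[OF assms(1)])
      fix j assume "j \<in> J"
      then show "g j x \<le> (SUP j\<in>J. g j y) + d"
        using cSUP_upper[OF _ bdd, of j y] that by fastforce
    qed
    then show ?thesis by simp
  qed
  have "g j x - g j y \<le> D x y" "g j y - g j x \<le> D x y" if "j \<in> J" for j
    using assms(3)[OF that, of x y] by linarith+
  from le[of x y, OF this(1)] le[of y x, OF this(2)] show ?thesis
    by (simp add: abs_le_iff)
qed

context ball_covering
begin

lemma eventually_Fin: "\<forall>\<^sub>F p in finite_subsets_at_top K. p \<in> Fin"
  unfolding eventually_finite_subsets_at_top Fin_def by (intro exI[of _ "{}"]) auto

lemma eventually_member:
  assumes "\<alpha> \<in> K"
  shows "\<forall>\<^sub>F p in finite_subsets_at_top K. \<alpha> \<in> p"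
  unfolding eventually_finite_subsets_at_top using assms by (intro exI[of _ "{\<alpha>}"]) auto

text \<open>
  At \<open>x + t (p, q)\<close> the cutoff \<open>2 - 8 * \<Delta>\<^sub>0 z (a \<alpha> + t i)\<close> is at least 1 for \<open>i = (p, q)\<close> and a suitable \<open>\<alpha>\<close>,
  and negative for all other \<open>i\<close>, so that only \<open>h p\<close> contributes to the supremum.
\<close>

lemma bullet_interpolation:
  assumes a: "\<And>x. \<exists>\<alpha>\<in>K. \<Delta>\<^sub>0 x (a \<alpha>) < 1 / 8"
    and t: "\<And>i j \<alpha> \<beta>. i \<in> Fin \<times> Fin \<Longrightarrow> j \<in> Fin \<times> Fin \<Longrightarrow> i \<noteq> j \<Longrightarrow> \<alpha> \<in> snd i \<Longrightarrow> \<beta> \<in> snd j \<Longrightarrow>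
      \<Delta>\<^sub>0 (a \<alpha> + t i) (a \<beta> + t j) \<ge> 1 / 2"
    and \<Delta>: "\<Delta> \<in> RP" and h: "\<And>p. p \<in> Fin \<Longrightarrow> h p \<in> BLip_b_plus \<Delta>"
  obtains f where "f \<in> LUC"
    "\<And>p x. p \<in> Fin \<Longrightarrow> \<forall>\<^sub>F q in finite_subsets_at_top K. f (x + t (p, q)) = h p x"
proof -
  define k where "k p x = Re (h p x)" for p x
  have hk: "h p x = complex_of_real (k p x)" and k: "0 \<le> k p x" "k p x \<le> 1"
    and k_lip: "\<bar>k p x - k p y\<bar> \<le> \<Delta> x y" if "p \<in> Fin" for p x y
  proof -
    have "\<exists>r\<in>{0..1}. h p x = complex_of_real r" for x
      using h[OF that] unfolding BLip_b_plus_def by blast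
    then show 1: "h p x = complex_of_real (k p x)" "0 \<le> k p x" "k p x \<le> 1" for x
      unfolding k_def by (metis Re_complex_of_real atLeastAtMost_iff)+
    have "cmod (h p x - h p y) \<le> \<Delta> x y"
      using h[OF that] unfolding BLip_b_plus_def by blast
    then show "\<bar>k p x - k p y\<bar> \<le> \<Delta> x y"
      unfolding 1(1) by (metis norm_of_real of_real_diff)
  qed
  define J where "J = {(p, q, \<alpha>). p \<in> Fin \<and> q \<in> Fin \<and> \<alpha> \<in> q}"
  define g where "g = (\<lambda>(p, q, \<alpha>) z. max 0 (min (k p (z - t (p, q))) (2 - 8 * \<Delta>\<^sub>0 z (a \<alpha> + t (p, q)))))"
  \<comment> \<open>A modulus common to all \<open>g j\<close>, and hence valid for their supremum:
    right invariance removes the shift by \<open>t (p, q)\<close> from \<open>\<Delta>\<close>, and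
    the cutoff has slope 8.\<close>
  define D where "D x y = \<Delta> x y + 8 * \<Delta>\<^sub>0 x y" for x y
  have D: "D \<in> RP"
    unfolding D_def by (intro RP_add \<Delta> RP_scale \<Delta>\<^sub>0) auto
  define f where "f z = (SUP j\<in>J. g j z)" for z
  obtain \<alpha>\<^sub>0 where "\<alpha>\<^sub>0 \<in> K"
    using a by blast
  then have j\<^sub>0: "({}, {\<alpha>\<^sub>0}, \<alpha>\<^sub>0) \<in> J"
    by (simp add: J_def Fin_def)
  then have J: "J \<noteq> {}" by blast
  have g_bounds: "0 \<le> g j z" "g j z \<le> 1" if "j \<in> J" for j z
    using that k(2) by (auto simp: g_def J_def min_le_iff_disj)
  have g_lip: "\<bar>g j z - g j w\<bar> \<le> D z w" if j: "j \<in> J" for j z w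
  proof -
    obtain p q \<alpha> where j': "j = (p, q, \<alpha>)" "p \<in> Fin"
      using j by (auto simp: J_def)
    have "\<bar>k p (z - t (p, q)) - k p (w - t (p, q))\<bar> \<le> \<Delta> z w"
      using k_lip[OF j'(2), of "z - t (p, q)" "w - t (p, q)"]
        RP_right_invariant[OF \<Delta>, of z "- t (p, q)" w] by simp
    moreover have "\<bar>\<Delta>\<^sub>0 z (a \<alpha> + t (p, q)) - \<Delta>\<^sub>0 w (a \<alpha> + t (p, q))\<bar> \<le> \<Delta>\<^sub>0 z w"
      using RP_triangle[OF \<Delta>\<^sub>0, of z "a \<alpha> + t (p, q)" w] RP_triangle[OF \<Delta>\<^sub>0, of w "a \<alpha> + t (p, q)" z]
        RP_commute[OF \<Delta>\<^sub>0, of z w] by linarith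
    ultimately show ?thesis
      using RP_nonneg[OF \<Delta>, of z w] RP_nonneg[OF \<Delta>\<^sub>0, of z w]
      unfolding j' g_def D_def prod.case by linarith
  qed
  have bdd: "bdd_above ((\<lambda>j. g j z) ` J)" for z
    using g_bounds(2) by (rule bdd_aboveI2)
  have f_upper: "g j z \<le> f z" if "j \<in> J" for j z
    unfolding f_def by (rule cSUP_upper[OF that bdd])
  have f_least: "f z \<le> c" if "\<And>j. j \<in> J \<Longrightarrow> g j z \<le> c" for z c
    unfolding f_def by (rule cSUP_least[OF J that])
  have f_bounds: "0 \<le> f z" "f z \<le> 1" for z
    using order_trans[OF g_bounds(1)[OF j\<^sub>0] f_upper[OF j\<^sub>0]] f_least[OF g_bounds(2)] by simp_all
  have "\<bar>f z - f w\<bar> \<le> D z w" for z w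
    unfolding f_def
    by (rule SUP_lipschitz[OF J, where M = 1]) (use g_bounds g_lip in auto)
  then have "(\<lambda>z. complex_of_real (f z)) \<in> clipschitz 1 D"
    unfolding clipschitz_def using f_bounds
    by (auto simp flip: of_real_diff)
  then have "(\<lambda>z. complex_of_real (f z)) \<in> LUC"
    using clipschitz_LUC[OF D] by blast
  moreover have "\<forall>\<^sub>F q in finite_subsets_at_top K. complex_of_real (f (x + t (p, q))) = h p x"
    if p: "p \<in> Fin" for p x
  proof -
    obtain \<alpha> where \<alpha>: "\<alpha> \<in> K" "\<Delta>\<^sub>0 x (a \<alpha>) < 1 / 8"
      using a by blast
    show ?thesis
      using eventually_Fin eventually_member[OF \<alpha>(1)]
    proof eventually_elim
      case (elim q)
      let ?z = "x + t (p, q)"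
      have near: "\<Delta>\<^sub>0 ?z (a \<alpha> + t (p, q)) < 1 / 8"
        using \<alpha>(2) RP_right_invariant[OF \<Delta>\<^sub>0] by simp
      have "f ?z = k p x"
      proof (rule antisym)
        have "g (p, q, \<alpha>) ?z = k p x"
          using near k[OF p, of x] by (simp add: g_def min_def max_def)
        moreover have "(p, q, \<alpha>) \<in> J"
          using p elim by (simp add: J_def)
        ultimately show "k p x \<le> f ?z"
          using f_upper by metis
        show "f ?z \<le> k p x"
        proof (rule f_least)
          fix j assume "j \<in> J"
          then obtain p' q' \<beta> where j: "j = (p', q', \<beta>)" "p' \<in> Fin" "q' \<in> Fin" "\<beta> \<in> q'"
            by (auto simp: J_def)
          show "g j ?z \<le> k p x"
          proof (cases "(p', q') = (p, q)")
            case True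
            then show ?thesis
              using k(1)[OF p, of x] by (simp add: j g_def)
          next
            case False
            then have "\<Delta>\<^sub>0 (a \<alpha> + t (p, q)) (a \<beta> + t (p', q')) \<ge> 1 / 2"
              using t[of "(p, q)" "(p', q')" \<alpha> \<beta>] p elim j by auto
            then have "\<Delta>\<^sub>0 ?z (a \<beta> + t (p', q')) \<ge> 3 / 8"
              using near RP_triangle[OF \<Delta>\<^sub>0, of "a \<alpha> + t (p, q)" "a \<beta> + t (p', q')" ?z]
                RP_commute[OF \<Delta>\<^sub>0, of ?z "a \<alpha> + t (p, q)"] by linarith
            then show ?thesis
              using k(1)[OF p, of x] by (simp add: j g_def)
          qed
        qed
      qed
      then show ?case
        by (simp add: hk[OF p])
    qed
  qed
  ultimately show ?thesis
    using that by blast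
qed

text \<open>The net \<open>f (x + t (p, q))\<close> is eventually constant in \<open>q\<close>, so
  \<open>bullet (\<nu> p) f\<close> is the same for every choice of cluster point. The points avoid
  the group because for each \<open>y\<close> a bump function equal to 1 at \<open>y\<close> is
  mapped to 0 by them.\<close>

lemma cluster_system:
  obtains \<nu> :: "('a + nat) set \<Rightarrow> ('a \<Rightarrow> complex) \<Rightarrow> complex" and \<nu>\<^sub>0
  where "\<And>p. p \<in> Fin \<Longrightarrow> \<nu> p \<in> uniform_compactification - range point_eval"
    "\<nu>\<^sub>0 \<in> uniform_compactification - range point_eval"
    "inf (nhds \<nu>\<^sub>0) (filtermap \<nu> (finite_subsets_at_top K)) \<noteq> bot"
    "\<And>\<Delta> h. \<Delta> \<in> RP \<Longrightarrow> (\<And>p. p \<in> Fin \<Longrightarrow> h p \<in> BLip_b_plus \<Delta>) \<Longrightarrow>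
      \<exists>f\<in>LUC. \<forall>p\<in>Fin. bullet (\<nu> p) f = h p"
proof -
  let ?F = "finite_subsets_at_top K"
  obtain a where a0: "\<And>x \<epsilon>. 0 < \<epsilon> \<Longrightarrow> \<exists>\<alpha>\<in>K. \<Delta>\<^sub>0 x (a \<alpha>) < \<epsilon>"
    using dense_family[OF \<Delta>\<^sub>0] by metis
  have a: "\<exists>\<alpha>\<in>K. \<Delta>\<^sub>0 x (a \<alpha>) < 1 / 8" for x
    by (rule a0) simp
  obtain t where t: "\<And>i j \<alpha> \<beta>. i \<in> Fin \<times> Fin \<Longrightarrow> j \<in> Fin \<times> Fin \<Longrightarrow> i \<noteq> j \<Longrightarrow> \<alpha> \<in> snd i \<Longrightarrow> \<beta> \<in> snd j \<Longrightarrow>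
      \<Delta>\<^sub>0 (a \<alpha> + t i) (a \<beta> + t j) \<ge> 1 / 2"
    using separated_family[of a] by metis
  have pe: "point_eval x \<in> uniform_compactification" for x :: 'a
    unfolding uniform_compactification_eq by (rule subsetD[OF closure_subset]) simp
  have "\<exists>\<nu>. \<nu> \<in> uniform_compactification \<and> inf (nhds \<nu>) (filtermap (\<lambda>q. point_eval (t (p, q))) ?F) \<noteq> bot" for p
    by (rule uniform_compactification_cluster_point[of _ "\<lambda>q. point_eval (t (p, q))",
          OF finite_subsets_at_top_neq_bot[of K] pe]) blast
  then obtain \<nu> where \<nu>: "\<And>p. \<nu> p \<in> uniform_compactification"
    "\<And>p. inf (nhds (\<nu> p)) (filtermap (\<lambda>q. point_eval (t (p, q))) ?F) \<noteq> bot"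
    by metis
  obtain \<nu>\<^sub>0 where \<nu>\<^sub>0: "\<nu>\<^sub>0 \<in> uniform_compactification" "inf (nhds \<nu>\<^sub>0) (filtermap \<nu> ?F) \<noteq> bot"
    by (rule uniform_compactification_cluster_point[of ?F \<nu>, OF finite_subsets_at_top_neq_bot \<nu>(1)]) blast
  have eval: "\<nu> p f = l" if "f \<in> LUC" "\<forall>\<^sub>F q in ?F. f (t (p, q)) = l" for p f l
  proof (rule cluster_point_coordinate[OF \<nu>(2)])
    show "((\<lambda>q. point_eval (t (p, q)) f) \<longlongrightarrow> l) ?F"
      by (rule tendsto_eventually) (use that in \<open>simp add: point_eval_def\<close>)
  qed
  obtain \<alpha> where \<alpha>: "\<alpha> \<in> K"
    using a by blast
  \<comment> \<open>Distances are measured after left translation by \<open>a \<alpha>\<close>,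
    since \<open>separated_family\<close> controls the points \<open>a \<alpha> + t (p, q)\<close>
    with \<open>\<alpha> \<in> q\<close>.\<close>
  define e where "e y z = complex_of_real (max 0 (1 - 4 * \<Delta>\<^sub>0 (a \<alpha> + z) (a \<alpha> + y)))" for y z
  have e: "e y \<in> LUC" for y
  proof -
    let ?D = "\<lambda>x z. 4 * \<Delta>\<^sub>0 (a \<alpha> + x) (a \<alpha> + z)"
    have "?D \<in> RP"
      by (intro RP_scale RP_left_translate \<Delta>\<^sub>0) auto
    moreover have "e y \<in> clipschitz 1 ?D"
    proof -
      have "cmod (e y x) \<le> 1" for x
        using RP_nonneg[OF \<Delta>\<^sub>0, of "a \<alpha> + x" "a \<alpha> + y"] by (simp add: e_def)
      moreover have "cmod (e y x - e y z) \<le> ?D x z" for x z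
      proof -
        have "cmod (e y x - e y z) = \<bar>max 0 (1 - 4 * \<Delta>\<^sub>0 (a \<alpha> + x) (a \<alpha> + y)) - max 0 (1 - 4 * \<Delta>\<^sub>0 (a \<alpha> + z) (a \<alpha> + y))\<bar>"
          unfolding e_def by (metis norm_of_real of_real_diff)
        also have "\<dots> \<le> ?D x z"
          using RP_triangle[OF \<Delta>\<^sub>0, of "a \<alpha> + x" "a \<alpha> + y" "a \<alpha> + z"]
            RP_triangle[OF \<Delta>\<^sub>0, of "a \<alpha> + z" "a \<alpha> + y" "a \<alpha> + x"]
            RP_commute[OF \<Delta>\<^sub>0, of "a \<alpha> + x" "a \<alpha> + z"]
            RP_nonneg[OF \<Delta>\<^sub>0, of "a \<alpha> + x" "a \<alpha> + z"] by linarith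
        finally show ?thesis .
      qed
      ultimately show ?thesis
        by (simp add: clipschitz_def)
    qed
    ultimately show ?thesis
      by (rule clipschitz_LUC)
  qed
  have vanish: "\<nu> p (e y) = 0" if p: "p \<in> Fin" for p y
  proof (rule eval[OF e])
    let ?near = "\<lambda>q. q \<in> Fin \<and> \<alpha> \<in> q \<and> \<Delta>\<^sub>0 (a \<alpha> + t (p, q)) (a \<alpha> + y) < 1 / 4"
    \<comment> \<open>Two such points would be less than 1/4 + 1/4 apart, against the separation by
      1/2.\<close>
    have unique: "q = q'" if "?near q" "?near q'" for q q'
      using t[of "(p, q)" "(p, q')" \<alpha> \<alpha>] that p
        RP_triangle[OF \<Delta>\<^sub>0, of "a \<alpha> + t (p, q)" "a \<alpha> + t (p, q')" "a \<alpha> + y"]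
        RP_commute[OF \<Delta>\<^sub>0, of "a \<alpha> + y" "a \<alpha> + t (p, q')"] by force
    \<comment> \<open>At most one \<open>q\<close> is exceptional, and it is finite; an index
      \<open>\<beta>\<close> outside it rules it out as soon as \<open>\<beta> \<in> q\<close> is
      required.\<close>
    obtain \<beta> where \<beta>: "\<beta> \<in> K" "\<And>q. ?near q \<Longrightarrow> \<beta> \<notin> q"
    proof (cases "\<exists>q. ?near q")
      case True
      then obtain q where q: "?near q" by blast
      then have "finite q"
        by (simp add: Fin_def)
      then obtain \<beta> where "\<beta> \<in> K" "\<beta> \<notin> q"
        using \<kappa>(1) by (meson finite_subset subsetI)
      then show ?thesis
        using that unique[OF q] by blast
    next
      case False
      then show ?thesis
        using that \<alpha> by blast
    qed
    show "\<forall>\<^sub>F q in ?F. e y (t (p, q)) = 0"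
      using eventually_Fin eventually_member[OF \<alpha>] eventually_member[OF \<beta>(1)]
    proof eventually_elim
      case (elim q)
      then have "\<not> \<Delta>\<^sub>0 (a \<alpha> + t (p, q)) (a \<alpha> + y) < 1 / 4"
        using \<beta>(2)[of q] by blast
      then show ?case
        by (simp add: e_def)
    qed
  qed
  have vanish\<^sub>0: "\<nu>\<^sub>0 (e y) = 0" for y
  proof (rule cluster_point_coordinate[OF \<nu>\<^sub>0(2)])
    show "((\<lambda>p. \<nu> p (e y)) \<longlongrightarrow> 0) ?F"
      by (rule tendsto_eventually) (use eventually_Fin in eventually_elim, rule vanish)
  qed
  have one: "point_eval y (e y) = 1" for y
    using e[of y] RP_refl[OF \<Delta>\<^sub>0] by (simp add: point_eval_def e_def)
  show ?thesis
  proof (rule that[of \<nu> \<nu>\<^sub>0])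
    show "\<nu> p \<in> uniform_compactification - range point_eval" if "p \<in> Fin" for p
      using \<nu>(1)[of p] vanish[OF that] one by (metis DiffI imageE zero_neq_one)
    show "\<nu>\<^sub>0 \<in> uniform_compactification - range point_eval"
      using \<nu>\<^sub>0(1) vanish\<^sub>0 one by (metis DiffI imageE zero_neq_one)
    show "inf (nhds \<nu>\<^sub>0) (filtermap \<nu> ?F) \<noteq> bot"
      by (rule \<nu>\<^sub>0(2))
    fix \<Delta> :: "'a \<Rightarrow> 'a \<Rightarrow> real" and h
    assume \<Delta>: "\<Delta> \<in> RP" and h: "\<And>p. p \<in> Fin \<Longrightarrow> h p \<in> BLip_b_plus \<Delta>"
    obtain f where f: "f \<in> LUC" "\<And>p x. p \<in> Fin \<Longrightarrow> \<forall>\<^sub>F q in ?F. f (x + t (p, q)) = h p x"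
      by (rule bullet_interpolation[of a t \<Delta> h], rule a, rule t, assumption+, rule \<Delta>, rule h,
          assumption, blast)
    have "bullet (\<nu> p) f x = h p x" if "p \<in> Fin" for p x
      unfolding bullet_def
      by (rule eval[OF LUC_left_translate[OF f(1)]]) (use f(2)[OF that] in \<open>simp add: left_translate_def\<close>)
    with f(1) show "\<exists>f\<in>LUC. \<forall>p\<in>Fin. bullet (\<nu> p) f = h p"
      by blast
  qed
qed

section \<open>From continuity at one point to uniform measures\<close>

text \<open>The functions share the modulus \<open>\<Delta>\<close>, so closeness on a dense family
  indexed by \<open>K\<close> governs pointwise convergence. A failure of continuity thus has a
  witnessing net over the finite subsets of \<open>K\<close>, the index set of the points
  \<open>\<nu> p\<close>.\<close>

lemma discontinuity_net:
  fixes \<Delta> :: "'a \<Rightarrow> 'a \<Rightarrow> real"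
  assumes \<Delta>: "\<Delta> \<in> RP" and "\<not> continuous_on (BLip_b_plus \<Delta>) \<mu>"
  obtains \<epsilon> h g where "0 < \<epsilon>" "\<And>p. p \<in> Fin \<Longrightarrow> h p \<in> BLip_b_plus \<Delta>"
    "\<And>p. p \<in> Fin \<Longrightarrow> \<epsilon> \<le> cmod (\<mu> (h p) - \<mu> g)"
    "\<And>x. ((\<lambda>p. h p x) \<longlongrightarrow> g x) (finite_subsets_at_top K)"
proof -
  let ?B = "BLip_b_plus \<Delta>" and ?F = "finite_subsets_at_top K"
  obtain g where g: "g \<in> ?B" "\<not> (\<mu> \<longlongrightarrow> \<mu> g) (at g within ?B)"
    using assms(2) unfolding continuous_on_def by blast
  then obtain \<epsilon> where \<epsilon>: "0 < \<epsilon>" "\<not> (\<forall>\<^sub>F h in at g within ?B. dist (\<mu> h) (\<mu> g) < \<epsilon>)"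
    unfolding tendsto_iff by blast
  obtain b where b: "\<And>x \<delta>. 0 < \<delta> \<Longrightarrow> \<exists>\<alpha>\<in>K. \<Delta> x (b \<alpha>) < \<delta>"
    using dense_family[OF \<Delta>] by metis
  \<comment> \<open>The tolerance shrinks with the size of \<open>p\<close>, so that enlarging
    \<open>p\<close> refines both the test points and the precision.\<close>
  define r where "r p = inverse (real (Suc (card p)))" for p :: "('a + nat) set"
  have "\<exists>h\<in>?B. (\<forall>\<alpha>\<in>p. cmod (h (b \<alpha>) - g (b \<alpha>)) < r p) \<and> \<epsilon> \<le> cmod (\<mu> h - \<mu> g)" if p: "p \<in> Fin" for p
  proof (rule ccontr)
    assume *: "\<not> ?thesis"
    define U where "U = {h. \<forall>\<alpha>\<in>p. cmod (h (b \<alpha>) - g (b \<alpha>)) < r p}"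
    have "open (\<Inter>\<alpha>\<in>p. {h :: 'a \<Rightarrow> complex. cmod (h (b \<alpha>) - g (b \<alpha>)) < r p})"
      using p by (intro open_INT ballI open_Collect_less continuous_on_norm continuous_on_diff
          continuous_on_proj continuous_on_const) (auto simp: Fin_def)
    moreover have "(\<Inter>\<alpha>\<in>p. {h :: 'a \<Rightarrow> complex. cmod (h (b \<alpha>) - g (b \<alpha>)) < r p}) = U"
      by (auto simp: U_def)
    ultimately have "open U" by simp
    moreover have "g \<in> U"
      by (simp add: U_def r_def)
    moreover have "dist (\<mu> h) (\<mu> g) < \<epsilon>" if "h \<in> U" "h \<in> ?B" for h
      using * that unfolding U_def dist_norm by (metis (mono_tags, lifting) mem_Collect_eq not_le)
    ultimately have "\<forall>\<^sub>F h in at g within ?B. dist (\<mu> h) (\<mu> g) < \<epsilon>"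
      unfolding eventually_at_topological by blast
    with \<epsilon>(2) show False by blast
  qed
  then obtain h where h: "\<And>p. p \<in> Fin \<Longrightarrow> h p \<in> ?B"
    "\<And>p \<alpha>. p \<in> Fin \<Longrightarrow> \<alpha> \<in> p \<Longrightarrow> cmod (h p (b \<alpha>) - g (b \<alpha>)) < r p"
    "\<And>p. p \<in> Fin \<Longrightarrow> \<epsilon> \<le> cmod (\<mu> (h p) - \<mu> g)"
    by metis
  have lip: "cmod (u x - u y) \<le> \<Delta> x y" if "u \<in> ?B" for u x y
    using that unfolding BLip_b_plus_def by blast
  have "((\<lambda>p. h p x) \<longlongrightarrow> g x) ?F" for x
    unfolding tendsto_iff
  proof (intro allI impI)
    fix \<delta> :: real assume "0 < \<delta>"
    then obtain \<alpha> where \<alpha>: "\<alpha> \<in> K" "\<Delta> x (b \<alpha>) < \<delta> / 3"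
      using b[of "\<delta> / 3"] by auto
    have "\<forall>\<^sub>F p in ?F. r p < \<delta> / 3"
      unfolding r_def using finite_subsets_at_top_card_tendsto[OF \<kappa>(1)] \<open>0 < \<delta>\<close>
      by (intro order_tendstoD(2)) auto
    with eventually_Fin eventually_member[OF \<alpha>(1)]
    show "\<forall>\<^sub>F p in ?F. dist (h p x) (g x) < \<delta>"
    proof eventually_elim
      case (elim p)
      have "cmod (h p x - g x) \<le> cmod (h p x - h p (b \<alpha>)) + cmod (h p (b \<alpha>) - g (b \<alpha>)) + cmod (g x - g (b \<alpha>))"
        using norm_triangle_ineq[of "h p x - h p (b \<alpha>)" "h p (b \<alpha>) - g (b \<alpha>)"]
          norm_triangle_ineq4[of "h p x - g (b \<alpha>)" "g x - g (b \<alpha>)"] by simp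
      then show ?case
        using lip[OF h(1)[OF elim(1)], of x "b \<alpha>"] lip[OF g(1), of x "b \<alpha>"] h(2)[OF elim(1,2)] elim(3) \<alpha>(2)
        unfolding dist_norm by linarith
    qed
  qed
  with \<epsilon>(1) h(1,3) show ?thesis
    using that by blast
qed

text \<open>The point is taken from \<open>cluster_system\<close> before \<open>S\<close> and
  \<open>\<mu>\<close> are given; only the interpolating \<open>f\<close> depends on
  \<open>\<mu>\<close>.\<close>

lemma one_point_determines_centre:
  obtains \<nu>\<^sub>0 :: "('a \<Rightarrow> complex) \<Rightarrow> complex"
  where "\<nu>\<^sub>0 \<in> uniform_compactification - range point_eval"
    "\<And>S \<mu>. S \<subseteq> LUC_dual \<Longrightarrow> uniform_compactification - range point_eval \<subseteq> S \<Longrightarrow> \<mu> \<in> S \<Longrightarrow>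
      left_mult_continuous_at S \<mu> \<nu>\<^sub>0 \<Longrightarrow> \<mu> \<in> uniform_measures"
proof -
  let ?F = "finite_subsets_at_top K"
  obtain \<nu> :: "('a + nat) set \<Rightarrow> ('a \<Rightarrow> complex) \<Rightarrow> complex" and \<nu>\<^sub>0
    where \<nu>: "\<And>p. p \<in> Fin \<Longrightarrow> \<nu> p \<in> uniform_compactification - range point_eval"
    and \<nu>\<^sub>0: "\<nu>\<^sub>0 \<in> uniform_compactification - range point_eval"
    and cluster: "inf (nhds \<nu>\<^sub>0) (filtermap \<nu> ?F) \<noteq> bot"
    and interp: "\<And>\<Delta> h. \<Delta> \<in> RP \<Longrightarrow> (\<And>p. p \<in> Fin \<Longrightarrow> h p \<in> BLip_b_plus \<Delta>) \<Longrightarrow>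
      \<exists>f\<in>LUC. \<forall>p\<in>Fin. bullet (\<nu> p) f = h p"
    by (rule cluster_system) blast
  show ?thesis
  proof (rule that[OF \<nu>\<^sub>0])
    fix S and \<mu> :: "('a \<Rightarrow> complex) \<Rightarrow> complex"
    assume S: "S \<subseteq> LUC_dual" "uniform_compactification - range point_eval \<subseteq> S" "\<mu> \<in> S"
      and cont: "left_mult_continuous_at S \<mu> \<nu>\<^sub>0"
    have "continuous_on (BLip_b_plus \<Delta>) \<mu>" if \<Delta>: "\<Delta> \<in> RP" for \<Delta>
    proof (rule ccontr)
      assume "\<not> ?thesis"
      then obtain \<epsilon> h g where \<epsilon>: "0 < \<epsilon>" and h: "\<And>p. p \<in> Fin \<Longrightarrow> h p \<in> BLip_b_plus \<Delta>"
        "\<And>p. p \<in> Fin \<Longrightarrow> \<epsilon> \<le> cmod (\<mu> (h p) - \<mu> g)" "\<And>x. ((\<lambda>p. h p x) \<longlongrightarrow> g x) ?F"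
        using discontinuity_net[OF \<Delta>] by blast
      obtain f where f: "f \<in> LUC" "\<And>p. p \<in> Fin \<Longrightarrow> bullet (\<nu> p) f = h p"
        using interp[of \<Delta> h] \<Delta> h(1) by blast
      have "bullet \<nu>\<^sub>0 f x = g x" for x
        unfolding bullet_def
      proof (rule cluster_point_coordinate[OF cluster])
        show "((\<lambda>p. \<nu> p (left_translate x f)) \<longlongrightarrow> g x) ?F"
        proof (rule Lim_transform_eventually[OF h(3)])
          show "\<forall>\<^sub>F p in ?F. h p x = \<nu> p (left_translate x f)"
            using eventually_Fin by eventually_elim (simp add: bullet_def flip: f(2))
        qed
      qed
      then have g: "bullet \<nu>\<^sub>0 f = g"
        by blast
      \<comment> \<open>Continuity forces values close to \<open>\<mu> g\<close> near
        \<open>\<nu>\<^sub>0\<close>, while the choice of \<open>h\<close> keeps them away along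
        \<open>\<nu> p\<close>. Both hold eventually in the filter of the cluster point, which is
        proper.\<close>
      have "\<forall>\<^sub>F \<xi> in inf (nhds \<nu>\<^sub>0) (filtermap \<nu> ?F). \<xi> \<in> S \<longrightarrow> cmod (\<mu> (bullet \<xi> f) - \<mu> g) < \<epsilon>"
        using left_mult_continuous_atD[OF S(1) cont f(1) \<epsilon>] unfolding g
        by (rule filter_leD[rotated]) simp
      moreover have "\<forall>\<^sub>F \<xi> in filtermap \<nu> ?F. \<xi> \<in> S \<and> \<epsilon> \<le> cmod (\<mu> (bullet \<xi> f) - \<mu> g)"
        unfolding eventually_filtermap using eventually_Fin
      proof eventually_elim
        case (elim p)
        then show ?case
          using subsetD[OF S(2) \<nu>] h(2) f(2) by simp
      qed
      then have "\<forall>\<^sub>F \<xi> in inf (nhds \<nu>\<^sub>0) (filtermap \<nu> ?F). \<xi> \<in> S \<and> \<epsilon> \<le> cmod (\<mu> (bullet \<xi> f) - \<mu> g)"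
        by (rule filter_leD[rotated]) simp
      ultimately have "\<forall>\<^sub>F \<xi> in inf (nhds \<nu>\<^sub>0) (filtermap \<nu> ?F). False"
        by eventually_elim auto
      with cluster show False
        by (simp add: eventually_False)
    qed
    then show "\<mu> \<in> uniform_measures"
      using S(1,3) by (auto simp: uniform_measures_def)
  qed
qed

end

theorem corollary3p3:
  fixes \<Delta>\<^sub>0 :: "'a::{topological_group_add, t2_space} \<Rightarrow> 'a \<Rightarrow> real"
    and S :: "(('a \<Rightarrow> complex) \<Rightarrow> complex) set"
  assumes "\<Delta>\<^sub>0 \<in> RP"
    and "eta_sharp \<Delta>\<^sub>0 =o boundedness_number TYPE('a)"
    and "subsemigroup_LUC_dual S"
    and "uniform_compactification - range point_eval \<subseteq> S"
  shows "\<exists>\<nu>\<^sub>0\<in>S. topological_centre S = uniform_measures \<inter> S \<and>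
                uniform_measures \<inter> S = {\<mu> \<in> S. left_mult_continuous_at S \<mu> \<nu>\<^sub>0}"
proof -
  interpret ball_covering "boundedness_number TYPE('a)" \<Delta>\<^sub>0
    by (rule ball_covering_boundedness_number[OF assms(1,2)])
  have S: "S \<subseteq> LUC_dual"
    using assms(3) by (simp add: subsemigroup_LUC_dual_def)
  obtain \<nu>\<^sub>0 where \<nu>\<^sub>0: "\<nu>\<^sub>0 \<in> uniform_compactification - range (point_eval :: 'a \<Rightarrow> _)"
    "\<And>S \<mu>. S \<subseteq> LUC_dual \<Longrightarrow> uniform_compactification - range point_eval \<subseteq> S \<Longrightarrow> \<mu> \<in> S \<Longrightarrow>
      left_mult_continuous_at S \<mu> \<nu>\<^sub>0 \<Longrightarrow> \<mu> \<in> uniform_measures"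
    by (rule one_point_determines_centre) blast
  \<comment> \<open>Hence membership in the centre includes continuity at
    \<open>\<nu>\<^sub>0\<close>. This closes the cycle of inclusions from the uniform measures in
    \<open>S\<close> to the centre, to continuity at \<open>\<nu>\<^sub>0\<close>, and back.\<close>
  have "\<nu>\<^sub>0 \<in> S"
    using \<nu>\<^sub>0(1) assms(4) by blast
  moreover have "left_mult_continuous_at S \<mu> \<nu>" if "\<mu> \<in> uniform_measures \<inter> S" "\<nu> \<in> S" for \<mu> \<nu>
    using uniform_measure_left_mult_continuous[OF assms(3)] that by blast
  ultimately show ?thesis
    using \<nu>\<^sub>0(2)[OF S assms(4)] unfolding topological_centre_def by blast
qed

end
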